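(* Let $(m,n,r)$ be a triple of natural numbers with $m,n\ge 1$, $\gcd(m,n)=\gcd(m,r-1)=1$ and $r^n\equiv 1 \pmod m$, and let $ZM(m,n,r)=\langle a,b \mid a^m=b^n=1,\ b^{-1}ab=a^r\rangle$. For divisors $m_1\mid m$ and $n_1\mid n$ let $H(m_1,n_1,0)=\langle a^{m_1},b^{n_1}\rangle$ and $cf_{m_1,n_1}=CF_2(H(m_1,n_1,0))$. Then the cyclic subgroup commutativity degree of $ZM(m,n,r)$ is $$csd(ZM(m,n,r))=\frac{\sum\limits_{m_1\mid m}\sum\limits_{n_1\mid n}\gcd\left(m_1,\frac{r^n-1}{r^{n_1}-1}\right)cf_{m_1,n_1}}{\left[\sum\limits_{m_1\mid m}\sum\limits_{\substack{n_1\mid n\\ \frac{m}{m_1}\mid r^{n_1}-1}}\gcd\left(m_1,\frac{r^n-1}{r^{n_1}-1}\right)\right]^2}.$$ In particular, $csd(ZM(9,4,8))=\frac{17}{25}$.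
   Context: For a finite group $G$, $L_1(G)$ denotes the set (poset) of all cyclic subgroups of $G$. The cyclic subgroup commutativity degree of $G$ is $csd(G)=\frac{1}{|L_1(G)|^2}|\{(H,K)\in L_1(G)^2\mid HK=KH\}|$, and the cyclic factorization number of $G$ is $CF_2(G)=|\{(H,K)\in L_1(G)^2\mid HK=G\}|$ (ordered pairs), where $HK=\{hk\mid h\in H,k\in K\}$. A ZM-group $ZM(m,n,r)$ is the finite group of order $mn$ given by the presentation in the claim under the stated conditions on $(m,n,r)$. When $r=1$ (which forces $m=1$), the quotient $\frac{r^n-1}{r^{k}-1}$, for $k\mid n$, is read as $\sum_{i=0}^{n/k-1} r^{ik}$. *)

theory Defs
  imports Complex_Main "HOL-Number_Theory.Cong" "HOL-Algebra.Algebra"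
begin

text \<open>A word is a list of signed generators: \<open>(x, True)\<close> stands for $x$ and \<open>(x, False)\<close>
  for $x^{-1}$.  A relation $u = v$ is the pair \<open>(u, v)\<close>.  Every element of the type \<open>'g\<close> is a
  generator.  Two words represent the same element of the presented group iff they are related by
  the least congruence for concatenation that contains the free cancellations and the relations.\<close>

type_synonym 'g word = "('g \<times> bool) list"

inductive word_eq :: "('g word \<times> 'g word) set \<Rightarrow> 'g word \<Rightarrow> 'g word \<Rightarrow> bool"
  for R :: "('g word \<times> 'g word) set" where
  refl: "word_eq R u u"
| sym: "word_eq R u v \<Longrightarrow> word_eq R v u"
| trans: "word_eq R u v \<Longrightarrow> word_eq R v w \<Longrightarrow> word_eq R u w"
| cancel: "word_eq R (u @ [(x, e), (x, \<not> e)] @ v) (u @ v)"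
| rel: "(p, q) \<in> R \<Longrightarrow> word_eq R (u @ p @ v) (u @ q @ v)"

definition word_class :: "('g word \<times> 'g word) set \<Rightarrow> 'g word \<Rightarrow> 'g word set" where
  "word_class R u = {v. word_eq R u v}"

definition presented_group :: "('g word \<times> 'g word) set \<Rightarrow> 'g word set monoid" where
  "presented_group R =
     \<lparr>carrier = range (word_class R),
      monoid.mult = (\<lambda>A B. \<Union>u\<in>A. \<Union>v\<in>B. word_class R (u @ v)),
      one = word_class R []\<rparr>"

lemma word_class_eq_iff: "word_class R u = word_class R v \<longleftrightarrow> word_eq R u v"
proof
  assume "word_class R u = word_class R v"
  moreover have "v \<in> word_class R v" by (simp add: word_class_def word_eq.refl)
  ultimately have "v \<in> word_class R u" by simp
  then show "word_eq R u v" by (simp add: word_class_def)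
next
  assume uv: "word_eq R u v"
  have "word_eq R u w \<longleftrightarrow> word_eq R v w" for w
    using word_eq.trans[OF uv] word_eq.trans[OF word_eq.sym[OF uv]] by metis
  then show "word_class R u = word_class R v" by (simp add: word_class_def)
qed

lemma word_eq_append_left: "word_eq R u v \<Longrightarrow> word_eq R (w @ u) (w @ v)"
proof (induction rule: word_eq.induct)
  case (cancel u x e v)
  show ?case using word_eq.cancel[of R "w @ u" x e v] by simp
next
  case (rel p q u v)
  then show ?case using word_eq.rel[of p q R "w @ u" v] by simp
next
  case refl
  show ?case by (rule word_eq.refl)
next
  case sym
  from word_eq.sym[OF sym.IH] show ?case .
next
  case trans
  from word_eq.trans[OF trans.IH] show ?case .
qed

lemma word_eq_append_right: "word_eq R u v \<Longrightarrow> word_eq R (u @ w) (v @ w)"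
proof (induction rule: word_eq.induct)
  case (cancel u x e v)
  show ?case using word_eq.cancel[of R u x e "v @ w"] by simp
next
  case (rel p q u v)
  then show ?case using word_eq.rel[of p q R u "v @ w"] by simp
next
  case refl
  show ?case by (rule word_eq.refl)
next
  case sym
  from word_eq.sym[OF sym.IH] show ?case .
next
  case trans
  from word_eq.trans[OF trans.IH] show ?case .
qed

lemma presented_group_mult:
  "word_class R u \<otimes>\<^bsub>presented_group R\<^esub> word_class R v = word_class R (u @ v)"
proof -
  have "word_class R (u' @ v') = word_class R (u @ v)"
    if "word_eq R u u'" "word_eq R v v'" for u' v'
    unfolding word_class_eq_iff
    by (rule word_eq.sym[OF word_eq.trans[OF word_eq_append_right[OF that(1)]
          word_eq_append_left[OF that(2)]]])
  then have "(\<Union>u'\<in>word_class R u. \<Union>v'\<in>word_class R v. word_class R (u' @ v'))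
      = (\<Union>u'\<in>word_class R u. \<Union>v'\<in>word_class R v. word_class R (u @ v))"
    by (intro SUP_cong HOL.refl) (simp_all add: word_class_def)
  moreover have "u \<in> word_class R u" "v \<in> word_class R v"
    by (simp_all add: word_class_def word_eq.refl)
  ultimately have "(\<Union>u'\<in>word_class R u. \<Union>v'\<in>word_class R v. word_class R (u' @ v'))
      = word_class R (u @ v)"
    by blast
  then show ?thesis by (simp add: presented_group_def)
qed

definition word_inv :: "'g word \<Rightarrow> 'g word" where
  "word_inv u = rev (map (\<lambda>(x, e). (x, \<not> e)) u)"

lemma word_inv_left: "word_eq R (word_inv u @ u) []"
proof (induction u)
  case Nil
  show ?case by (simp add: word_inv_def word_eq.refl)
next
  case (Cons y u)
  obtain x e where y: "y = (x, e)" by force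
  have "word_eq R (word_inv (y # u) @ (y # u)) (word_inv u @ u)"
    using word_eq.cancel[of R "word_inv u" x "\<not> e" u] by (simp add: y word_inv_def)
  from word_eq.trans[OF this Cons] show ?case .
qed

lemma group_presented_group: "group (presented_group R)"
proof (rule groupI)
  fix x y z
  assume "x \<in> carrier (presented_group R)" "y \<in> carrier (presented_group R)"
    "z \<in> carrier (presented_group R)"
  then obtain u v w where "x = word_class R u" "y = word_class R v" "z = word_class R w"
    by (auto simp: presented_group_def)
  then show "x \<otimes>\<^bsub>presented_group R\<^esub> y \<otimes>\<^bsub>presented_group R\<^esub> z =
      x \<otimes>\<^bsub>presented_group R\<^esub> (y \<otimes>\<^bsub>presented_group R\<^esub> z)"
    by (simp add: presented_group_mult)
next
  fix x assume "x \<in> carrier (presented_group R)"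
  then obtain u where u: "x = word_class R u" by (auto simp: presented_group_def)
  have one: "\<one>\<^bsub>presented_group R\<^esub> = word_class R []" by (simp add: presented_group_def)
  show "\<one>\<^bsub>presented_group R\<^esub> \<otimes>\<^bsub>presented_group R\<^esub> x = x"
    unfolding one u presented_group_mult by simp
  have "word_class R (word_inv u) \<otimes>\<^bsub>presented_group R\<^esub> x = \<one>\<^bsub>presented_group R\<^esub>"
    unfolding one u presented_group_mult word_class_eq_iff by (rule word_inv_left)
  moreover have "word_class R (word_inv u) \<in> carrier (presented_group R)"
    by (simp add: presented_group_def)
  ultimately show "\<exists>y\<in>carrier (presented_group R). y \<otimes>\<^bsub>presented_group R\<^esub> x = \<one>\<^bsub>presented_group R\<^esub>"
    by blast
next
  fix x y
  assume "x \<in> carrier (presented_group R)" "y \<in> carrier (presented_group R)"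
  then obtain u v where "x = word_class R u" "y = word_class R v"
    by (auto simp: presented_group_def)
  then have "x \<otimes>\<^bsub>presented_group R\<^esub> y = word_class R (u @ v)"
    by (simp add: presented_group_mult)
  then show "x \<otimes>\<^bsub>presented_group R\<^esub> y \<in> carrier (presented_group R)"
    by (simp add: presented_group_def)
next
  show "\<one>\<^bsub>presented_group R\<^esub> \<in> carrier (presented_group R)"
    by (simp add: presented_group_def)
qed

datatype zm_gen = GenA | GenB

definition zm_relations :: "nat \<Rightarrow> nat \<Rightarrow> nat \<Rightarrow> (zm_gen word \<times> zm_gen word) set" where
  "zm_relations m n r =
     {(replicate m (GenA, True), []),
      (replicate n (GenB, True), []),
      ([(GenB, False), (GenA, True), (GenB, True)], replicate r (GenA, True))}"

definition ZM :: "nat \<Rightarrow> nat \<Rightarrow> nat \<Rightarrow> zm_gen word set monoid" where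
  "ZM m n r = presented_group (zm_relations m n r)"

definition zm_a :: "nat \<Rightarrow> nat \<Rightarrow> nat \<Rightarrow> zm_gen word set" where
  "zm_a m n r = word_class (zm_relations m n r) [(GenA, True)]"

definition zm_b :: "nat \<Rightarrow> nat \<Rightarrow> nat \<Rightarrow> zm_gen word set" where
  "zm_b m n r = word_class (zm_relations m n r) [(GenB, True)]"

definition zm_H0 :: "nat \<Rightarrow> nat \<Rightarrow> nat \<Rightarrow> nat \<Rightarrow> nat \<Rightarrow> zm_gen word set monoid" where
  "zm_H0 m n r m1 n1 =
     subgroup_generated (ZM m n r)
       {zm_a m n r [^]\<^bsub>ZM m n r\<^esub> m1, zm_b m n r [^]\<^bsub>ZM m n r\<^esub> n1}"

text \<open>The quotient $\frac{r^n-1}{r^k-1}$ for $k \mid n$.  The division is exact; it is taken over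
  the integers so that $r = 0$ (which the hypotheses on $(m,n,r)$ allow when $m = 1$) gives
  $(-1)/(-1) = 1$.  For $r = 1$ the quotient is $0/0$ and is read as a geometric sum.\<close>

definition zm_quot :: "nat \<Rightarrow> nat \<Rightarrow> nat \<Rightarrow> int" where
  "zm_quot r n k =
     (if r = 1 then (\<Sum>i<n div k. int r ^ (i * k))
      else (int r ^ n - 1) div (int r ^ k - 1))"

definition cyclic_subgroups :: "('a, 'b) monoid_scheme \<Rightarrow> 'a set set" where
  "cyclic_subgroups G = {H. subgroup H G \<and> cyclic_group (G\<lparr>carrier := H\<rparr>)}"

definition csd :: "('a, 'b) monoid_scheme \<Rightarrow> real" where
  "csd G =
     real (card {(H, K). H \<in> cyclic_subgroups G \<and> K \<in> cyclic_subgroups G \<and>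
                         H <#>\<^bsub>G\<^esub> K = K <#>\<^bsub>G\<^esub> H})
       / (real (card (cyclic_subgroups G)))\<^sup>2"

definition CF2 :: "('a, 'b) monoid_scheme \<Rightarrow> nat" where
  "CF2 G =
     card {(H, K). H \<in> cyclic_subgroups G \<and> K \<in> cyclic_subgroups G \<and>
                   H <#>\<^bsub>G\<^esub> K = carrier G}"

end

(*
Let e(i, j) = b^j a^i, so that e(i, j) e(i', j') = e(i r^j' + i', j + j'). Every subgroup is
generated by some a^m1 and b^n1 conjugated by a power a^t: it consists of the e(i, j) with n1 | j
and m1 | i + t (r^j - 1), and so depends on t only modulo q = gcd(m1, (r^n - 1)/(r^n1 - 1)), because
m1 divides (r^n - 1) and coprimality of m1 and n/n1 gives q * gcd(m1, r^n1 - 1) = m1.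
Two cyclic subgroups H, K permute iff L = HK is a subgroup, so the permuting pairs are the
cyclic factorizations of the various subgroups L, whose number is invariant under conjugation.
*)
theory Submission
  imports Defs
begin

text \<open>Equality of words is only given by a congruence, so the presentation directly yields an
  upper bound on the order of the group. The group theory therefore takes place in the locale
  \<open>metacyclic\<close>, which assumes uniqueness of the form \<open>b ^ j a ^ i\<close>, and
  the presented group earns this assumption from an action on the \<open>m * n\<close> pairs of
  residues. That the shifts \<open>t\<close> exhaust all subgroups needs an argument. A subgroup
  contains some \<open>b ^ n1 a ^ s\<close>, and the identity is reached from its power with
  exponent \<open>n / n1\<close> by a power of \<open>a ^ m1\<close>. This forces
  \<open>gcd(m1, r ^ n1 - 1)\<close> to divide \<open>s\<close>, which is just what makes
  \<open>s + t * (r ^ n1 - 1) = 0\<close> solvable modulo \<open>m1\<close>. Exponents of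
  \<open>a\<close> and \<open>b\<close> are natural numbers, so an exponent \<open>- x\<close> of
  \<open>a\<close> appears as \<open>(m - 1) * x\<close>. The value 17/25 is 153/225: there are 15
  cyclic subgroups, and the only pairs that fail to permute consist of two distinct ones among the 9
  Sylow 2-subgroups.\<close>

section \<open>Cyclic subgroups, permutability and factorizations in an arbitrary group\<close>

context group
begin

text \<open>The form with an explicit generator makes finiteness and the behaviour under
  automorphisms immediate.\<close>

lemma cyclic_subgroups_eq: "cyclic_subgroups G = (\<lambda>x. generate G {x}) ` carrier G"
proof -
  have "cyclic_group (G\<lparr>carrier := H\<rparr>) \<longleftrightarrow> (\<exists>x\<in>H. H = generate G {x})" if H: "subgroup H G" for H
  proof -
    interpret H: group "G\<lparr>carrier := H\<rparr>" using subgroup_imp_group[OF H] .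
    have "range (\<lambda>k::int. x [^]\<^bsub>G\<lparr>carrier := H\<rparr>\<^esub> k) = generate G {x}" if "x \<in> H" for x
      using that int_pow_consistent[OF H that] generate_pow[of x] subgroup.mem_carrier[OF H that]
      by auto
    then show ?thesis by (simp add: H.cyclic_group)
  qed
  moreover have "subgroup (generate G {x}) G" "x \<in> generate G {x}" if "x \<in> carrier G" for x
    using that by (auto intro: generate_is_subgroup generate.incl)
  moreover have "x \<in> carrier G" if "x \<in> H" "subgroup H G" for x H
    using that by (auto dest: subgroup.mem_carrier)
  ultimately show ?thesis
    unfolding cyclic_subgroups_def image_def by blast
qed

lemma cyclic_subgroupsD: "H \<in> cyclic_subgroups G \<Longrightarrow> subgroup H G"
  by (simp add: cyclic_subgroups_def)

text \<open>If \<open>H\<close> and \<open>K\<close> permute, then \<open>H K H K\<close> regroups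
  to \<open>H H K K = H K\<close>, and inversion sends \<open>H K\<close> into \<open>K H\<close>.
  Conversely, inversion in the subgroup \<open>H K\<close> gives one inclusion and closure under
  products the other.\<close>

lemma permutable_iff_subgroup:
  assumes H: "subgroup H G" and K: "subgroup K G"
  shows "H <#> K = K <#> H \<longleftrightarrow> subgroup (H <#> K) G"
proof
  note [simp] = subgroup.mem_carrier[OF H] subgroup.mem_carrier[OF K]
    subgroup.m_inv_closed[OF H] subgroup.m_inv_closed[OF K] subgroup.one_closed[OF H]
    subgroup.one_closed[OF K]
  have HG: "H \<subseteq> carrier G" and KG: "K \<subseteq> carrier G" by auto
  {
    assume comm: "H <#> K = K <#> H"
    have "(H <#> K) <#> (H <#> K) = (H <#> H) <#> (K <#> K)"
      using HG KG comm by (metis set_mult_assoc set_mult_closed)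
    then have mul: "(H <#> K) <#> (H <#> K) = H <#> K"
      by (simp add: set_mult_subgroup_idem[OF H subgroup_incl[OF H H]]
          set_mult_subgroup_idem[OF K subgroup_incl[OF K K]])
    show "subgroup (H <#> K) G"
    proof (rule subgroupI)
      show "H <#> K \<subseteq> carrier G" by (rule set_mult_closed[OF HG KG])
      show "H <#> K \<noteq> {}" using subgroup.one_closed[OF H] subgroup.one_closed[OF K]
        unfolding set_mult_def by blast
    next
      fix x assume "x \<in> H <#> K"
      then obtain h k where "h \<in> H" "k \<in> K" "x = h \<otimes> k" unfolding set_mult_def by auto
      then have "inv x = inv k \<otimes> inv h" "inv k \<in> K" "inv h \<in> H" by (simp_all add: inv_mult_group)
      then have "inv x \<in> K <#> H" unfolding set_mult_def by auto
      then show "inv x \<in> H <#> K" by (simp add: comm)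
    next
      fix x y assume "x \<in> H <#> K" "y \<in> H <#> K"
      then have "x \<otimes> y \<in> (H <#> K) <#> (H <#> K)" unfolding set_mult_def by auto
      then show "x \<otimes> y \<in> H <#> K" by (simp add: mul)
    qed
  next
    assume S: "subgroup (H <#> K) G"
    show "H <#> K = K <#> H"
    proof (intro equalityI subsetI)
      fix x assume x: "x \<in> H <#> K"
      then have "inv x \<in> H <#> K" by (rule subgroup.m_inv_closed[OF S])
      then obtain h k where hk: "h \<in> H" "k \<in> K" "inv x = h \<otimes> k" unfolding set_mult_def by auto
      have "x = inv (inv x)" using subgroup.mem_carrier[OF S x] by simp
      then have "x = inv k \<otimes> inv h" "inv k \<in> K" "inv h \<in> H"
        using hk by (simp_all add: inv_mult_group)
      then show "x \<in> K <#> H" unfolding set_mult_def by auto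
    next
      fix x assume "x \<in> K <#> H"
      then obtain h k where hk: "h \<in> H" "k \<in> K" "x = k \<otimes> h" unfolding set_mult_def by auto
      have "h \<otimes> \<one> \<in> H <#> K" "\<one> \<otimes> k \<in> H <#> K"
        using hk subgroup.one_closed[OF H] subgroup.one_closed[OF K] unfolding set_mult_def by blast+
      then have "(\<one> \<otimes> k) \<otimes> (h \<otimes> \<one>) \<in> H <#> K" using subgroup.m_closed[OF S] by blast
      then show "x \<in> H <#> K" using hk by simp
    qed
  }
qed

lemma subset_set_mult:
  assumes H: "subgroup H G" and K: "subgroup K G"
  shows "H \<subseteq> H <#> K" "K \<subseteq> H <#> K"
proof -
  have "h \<otimes> \<one> \<in> H <#> K" if "h \<in> H" for h
    using that subgroup.one_closed[OF K] unfolding set_mult_def by blast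
  moreover have "\<one> \<otimes> k \<in> H <#> K" if "k \<in> K" for k
    using that subgroup.one_closed[OF H] unfolding set_mult_def by blast
  ultimately show "H \<subseteq> H <#> K" "K \<subseteq> H <#> K"
    using subgroup.mem_carrier[OF H] subgroup.mem_carrier[OF K] by auto
qed

end

text \<open>The pairs are counted inside the ambient group, so that factorizations of different
  \<open>L\<close> can be united and moved by automorphisms of \<open>G\<close>;
  \<open>CF2_restrict\<close> connects this count with \<open>CF2\<close>.\<close>

definition cyclic_factorizations :: "('a, 'b) monoid_scheme \<Rightarrow> 'a set \<Rightarrow> ('a set \<times> 'a set) set" where
  "cyclic_factorizations G L =
     {(H, K). H \<in> cyclic_subgroups G \<and> K \<in> cyclic_subgroups G \<and> H <#>\<^bsub>G\<^esub> K = L}"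

context group
begin

lemma cyclic_subgroups_restrict:
  assumes L: "subgroup L G"
  shows "cyclic_subgroups (G\<lparr>carrier := L\<rparr>) = {H \<in> cyclic_subgroups G. H \<subseteq> L}"
  using subgroup_incl[OF _ L] incl_subgroup[OF L] subgroup.subset[of _ "G\<lparr>carrier := L\<rparr>"]
  by (auto simp: cyclic_subgroups_def)

text \<open>Each factor is contained in the product, so cyclic subgroups of \<open>G\<close> with
  product \<open>L\<close> automatically lie in \<open>L\<close>.\<close>

lemma CF2_restrict:
  assumes L: "subgroup L G"
  shows "CF2 (G\<lparr>carrier := L\<rparr>) = card (cyclic_factorizations G L)"
proof -
  have "H <#>\<^bsub>G\<lparr>carrier := L\<rparr>\<^esub> K = H <#> K" for H K by (simp add: set_mult_def)
  then have "CF2 (G\<lparr>carrier := L\<rparr>) = card {(H, K). H \<in> {H \<in> cyclic_subgroups G. H \<subseteq> L}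
      \<and> K \<in> {H \<in> cyclic_subgroups G. H \<subseteq> L} \<and> H <#> K = L}"
    unfolding CF2_def cyclic_subgroups_restrict[OF L] by simp
  also have "{(H, K). H \<in> {H \<in> cyclic_subgroups G. H \<subseteq> L}
      \<and> K \<in> {H \<in> cyclic_subgroups G. H \<subseteq> L} \<and> H <#> K = L} = cyclic_factorizations G L"
    unfolding cyclic_factorizations_def using subset_set_mult cyclic_subgroupsD by blast
  finally show ?thesis .
qed

lemma finite_cyclic_subgroups: "finite (carrier G) \<Longrightarrow> finite (cyclic_subgroups G)"
  by (simp add: cyclic_subgroups_eq)

lemma finite_cyclic_factorizations:
  "finite (carrier G) \<Longrightarrow> finite (cyclic_factorizations G L)"
  by (rule finite_subset[of _ "cyclic_subgroups G \<times> cyclic_subgroups G"])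
    (auto simp: cyclic_factorizations_def finite_cyclic_subgroups)

lemma iso_image_cyclic_subgroup:
  assumes "f \<in> iso G G" "H \<in> cyclic_subgroups G"
  shows "f ` H \<in> cyclic_subgroups G"
proof -
  interpret f: group_hom G G f
    using assms(1) by (unfold_locales) (auto simp: iso_def)
  from assms(2) obtain x where "x \<in> carrier G" "H = generate G {x}"
    by (auto simp: cyclic_subgroups_eq)
  then have "f ` H = generate G {f x}" "f x \<in> carrier G" using f.generate_img[of "{x}"] by simp_all
  then show ?thesis by (auto simp: cyclic_subgroups_eq)
qed

lemma iso_image_cyclic_subgroup_iff:
  assumes f: "f \<in> iso G G" and H: "H \<subseteq> carrier G"
  shows "f ` H \<in> cyclic_subgroups G \<longleftrightarrow> H \<in> cyclic_subgroups G"
proof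
  assume "f ` H \<in> cyclic_subgroups G"
  then have "inv_into (carrier G) f ` f ` H \<in> cyclic_subgroups G"
    by (rule iso_image_cyclic_subgroup[OF iso_set_sym[OF f]])
  moreover have "inv_into (carrier G) f ` f ` H = H"
    using f H by (intro inv_into_image_cancel) (auto simp: iso_def bij_betw_def)
  ultimately show "H \<in> cyclic_subgroups G" by simp
qed (rule iso_image_cyclic_subgroup[OF f])

text \<open>Taking images of both factors is injective and respects products. Applied to the inverse
  automorphism as well, the inequality becomes an equality in the next lemma.\<close>

lemma card_cyclic_factorizations_iso_le:
  assumes fin: "finite (carrier G)" and f: "f \<in> iso G G"
  shows "card (cyclic_factorizations G L) \<le> card (cyclic_factorizations G (f ` L))"
proof (rule card_inj_on_le[of "map_prod (image f) (image f)"])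
  have sub: "H \<subseteq> carrier G" if "H \<in> cyclic_subgroups G" for H
    using that by (auto dest!: cyclic_subgroupsD subgroup.subset)
  have "inj_on (image f) (cyclic_subgroups G)"
    using f sub by (auto simp: iso_def bij_betw_def intro!: inj_on_image inj_on_subset[where A = "carrier G"])
  then have "inj_on (map_prod (image f) (image f)) (cyclic_subgroups G \<times> cyclic_subgroups G)"
    by (intro map_prod_inj_on)
  then show "inj_on (map_prod (image f) (image f)) (cyclic_factorizations G L)"
    by (rule inj_on_subset) (auto simp: cyclic_factorizations_def)
  have "f ` H <#> f ` K = f ` (H <#> K)" if "H \<in> cyclic_subgroups G" "K \<in> cyclic_subgroups G" for H K
    using set_mult_hom[of f G G H K] f that sub by (auto simp: iso_def)
  then show "map_prod (image f) (image f) ` cyclic_factorizations G L \<subseteq> cyclic_factorizations G (f ` L)"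
    using iso_image_cyclic_subgroup[OF f] by (auto simp: cyclic_factorizations_def)
  show "finite (cyclic_factorizations G (f ` L))" by (rule finite_cyclic_factorizations[OF fin])
qed

lemma card_cyclic_factorizations_iso:
  assumes fin: "finite (carrier G)" and f: "f \<in> iso G G" and L: "L \<subseteq> carrier G"
  shows "card (cyclic_factorizations G (f ` L)) = card (cyclic_factorizations G L)"
proof (rule antisym[OF _ card_cyclic_factorizations_iso_le[OF fin f]])
  have "inv_into (carrier G) f ` f ` L = L"
    using f L by (intro inv_into_image_cancel) (auto simp: iso_def bij_betw_def)
  then show "card (cyclic_factorizations G (f ` L)) \<le> card (cyclic_factorizations G L)"
    using card_cyclic_factorizations_iso_le[OF fin iso_set_sym[OF f], of "f ` L"] by simp
qed

lemma card_permutable_cyclic: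
  assumes fin: "finite (carrier G)"
  shows "card {(H, K). H \<in> cyclic_subgroups G \<and> K \<in> cyclic_subgroups G \<and> H <#> K = K <#> H}
    = (\<Sum>L | subgroup L G. card (cyclic_factorizations G L))"
proof -
  have "{(H, K). H \<in> cyclic_subgroups G \<and> K \<in> cyclic_subgroups G \<and> H <#> K = K <#> H}
    = (\<Union>L\<in>{L. subgroup L G}. cyclic_factorizations G L)"
    \<comment> \<open>A pair determines its product, so this union is disjoint and the cardinalities
      add up.\<close>
    unfolding cyclic_factorizations_def using permutable_iff_subgroup cyclic_subgroupsD by blast
  moreover have "finite {L. subgroup L G}"
    by (rule finite_subset[of _ "Pow (carrier G)"]) (use fin in \<open>auto dest: subgroup.subset\<close>)
  ultimately show ?thesis
    by (simp only:, subst card_UN_disjoint)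
      (auto simp: finite_cyclic_factorizations[OF fin], auto simp: cyclic_factorizations_def)
qed

end

section \<open>Normal forms in a metacyclic group\<close>

lemma (in group) finite_subgroupI:
  assumes fin: "finite (carrier G)" and S: "S \<subseteq> carrier G" "S \<noteq> {}"
    and mult: "\<And>x y. x \<in> S \<Longrightarrow> y \<in> S \<Longrightarrow> x \<otimes> y \<in> S"
  shows "subgroup S G"
proof (rule subgroupI[OF S _ mult])
  fix x assume x: "x \<in> S"
  then have xG: "x \<in> carrier G" using S by auto
  have pow: "x [^] Suc k \<in> S" for k by (induction k) (use x xG mult in auto)
  have "order G > 0" using fin order_gt_0_iff_finite by blast
  \<comment> \<open>The inverse of \<open>x\<close> is its power with exponent
    \<open>2 * order G - 1\<close>. Doubling the order keeps this exponent positive even in the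
    trivial group, so that \<open>pow\<close> applies.\<close>
  then obtain k where k: "order G + order G = Suc (Suc k)" by (cases "order G") auto
  have "x [^] Suc k \<otimes> x = x [^] (order G + order G)" by (simp add: k)
  also have "\<dots> = \<one>" by (simp add: nat_pow_mult[symmetric] xG pow_order_eq_1)
  finally have "inv x = x [^] Suc k" using xG by (intro inv_equality) auto
  then show "inv x \<in> S" using pow by simp
qed

text \<open>Such a \<open>J\<close> consists of the nonnegative members of an ideal of the integers
  that contains \<open>n\<close>, and \<open>d\<close> is its least positive member. It is applied
  to the exponents of \<open>a\<close> and of \<open>b\<close> that occur in a subgroup.\<close>

lemma nat_ideal_principal:
  fixes J :: "nat set"
  assumes n: "n > 0" "n \<in> J"
    and add: "\<And>i j. i \<in> J \<Longrightarrow> j \<in> J \<Longrightarrow> i + j \<in> J"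
    and cong: "\<And>i j. i \<in> J \<Longrightarrow> [i = j] (mod n) \<Longrightarrow> j \<in> J"
  obtains d where "d dvd n" "\<And>j. j \<in> J \<longleftrightarrow> d dvd j"
proof -
  define d where "d = (LEAST j. j > 0 \<and> j \<in> J)"
  have d: "d > 0" "d \<in> J" unfolding d_def by (rule LeastI2[of _ n]; use n in simp)+
  have least: "j = 0" if "j \<in> J" "j < d" for j
    using not_less_Least[of j "\<lambda>j. j > 0 \<and> j \<in> J"] that unfolding d_def by auto
  have 0: "0 \<in> J" by (rule cong[OF n(2)]) (simp add: cong_def)
  have mul: "j * k \<in> J" if "j \<in> J" for j k
    by (induction k) (use 0 add that in auto)
  have "d dvd j" if "j \<in> J" for j
  proof -
    \<comment> \<open>Adding \<open>(n - 1) * (j div d)\<close> copies of \<open>d\<close> amounts,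
      modulo \<open>n\<close>, to subtracting \<open>j div d\<close> copies, which leaves the
      remainder \<open>j mod d\<close>.\<close>
    have "j + d * ((n - 1) * (j div d)) \<in> J" using add[OF that mul[OF d(2)]] .
    moreover have "j + d * ((n - 1) * (j div d)) = j mod d + n * (d * (j div d))"
    proof -
      have "j + d * ((n - 1) * (j div d)) = j mod d + d * (j div d) + d * ((n - 1) * (j div d))"
        by simp
      also have "\<dots> = j mod d + (1 + (n - 1)) * (d * (j div d))" by (simp add: algebra_simps)
      also have "1 + (n - 1) = n" using n by simp
      finally show ?thesis .
    qed
    ultimately have "j mod d \<in> J" using cong[of _ "j mod d"] by (metis cong_add_lcancel_0_nat cong_def cong_mult_self_left)
    then have "j mod d = 0" using least d by simp
    then show ?thesis by auto
  qed
  moreover have "j \<in> J" if "d dvd j" for j using that mul[OF d(2)] by auto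
  ultimately show ?thesis using that[of d] n by blast
qed

text \<open>This is the interface between the presentation and the group theory. The relation is
  stated as \<open>a b = b a ^ r\<close>, which moves powers of \<open>a\<close> to the right
  without inverses. Generation bounds the order by \<open>m * n\<close> from above,
  \<open>normal_form_unique\<close> from below.\<close>

locale metacyclic = group G for G (structure) +
  fixes a b :: 'a and m n r :: nat
  assumes a [simp]: "a \<in> carrier G" and b [simp]: "b \<in> carrier G"
    and m: "m > 0" and n: "n > 0" and coprime: "coprime m n" and r: "[r ^ n = 1] (mod m)"
    and a_pow: "a [^] m = \<one>" and b_pow: "b [^] n = \<one>" and ab: "a \<otimes> b = b \<otimes> a [^] r"
    and carrier_generate: "carrier G \<subseteq> generate G {a, b}"
    and normal_form_unique: "\<And>i j i' j' :: nat. b [^] j \<otimes> a [^] i = b [^] j' \<otimes> a [^] i'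
      \<Longrightarrow> [i = i'] (mod m) \<and> [j = j'] (mod n)"
begin

definition nf :: "nat \<Rightarrow> nat \<Rightarrow> 'a" where
  "nf i j = b [^] j \<otimes> a [^] i"

lemma nf_closed [simp]: "nf i j \<in> carrier G"
  by (simp add: nf_def)

lemma a_pow_mult_b: "a [^] i \<otimes> b = b \<otimes> a [^] (i * r)" for i :: nat
proof (induction i)
  case (Suc i)
  have "a [^] Suc i \<otimes> b = a [^] i \<otimes> (b \<otimes> a [^] r)" by (simp add: m_assoc ab)
  also have "\<dots> = (b \<otimes> a [^] (i * r)) \<otimes> a [^] r" by (simp add: Suc m_assoc[symmetric])
  also have "\<dots> = b \<otimes> a [^] (Suc i * r)" by (simp add: m_assoc nat_pow_mult add.commute)
  finally show ?case .
qed simp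

lemma a_pow_mult_b_pow: "a [^] i \<otimes> b [^] j = b [^] j \<otimes> a [^] (i * r ^ j)" for i j :: nat
proof (induction j)
  case (Suc j)
  have "a [^] i \<otimes> b [^] Suc j = (b [^] j \<otimes> a [^] (i * r ^ j)) \<otimes> b"
    by (simp add: m_assoc[symmetric] Suc)
  also have "\<dots> = b [^] j \<otimes> (b \<otimes> a [^] (i * r ^ j * r))" by (simp add: m_assoc a_pow_mult_b)
  also have "\<dots> = b [^] Suc j \<otimes> a [^] (i * r ^ Suc j)" by (simp add: m_assoc[symmetric] ac_simps)
  finally show ?case .
qed simp

lemma nf_mult: "nf i j \<otimes> nf i' j' = nf (i * r ^ j' + i') (j + j')"
proof -
  have "nf i j \<otimes> nf i' j' = b [^] j \<otimes> (a [^] i \<otimes> b [^] j') \<otimes> a [^] i'"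
    by (simp add: nf_def m_assoc)
  also have "\<dots> = (b [^] j \<otimes> b [^] j') \<otimes> (a [^] (i * r ^ j') \<otimes> a [^] i')"
    by (simp add: a_pow_mult_b_pow m_assoc)
  finally show ?thesis by (simp add: nf_def nat_pow_mult)
qed

lemma nf_0_0 [simp]: "nf 0 0 = \<one>"
  by (simp add: nf_def)

lemma nf_a_pow: "a [^] i = nf i 0" and nf_b_pow: "b [^] j = nf 0 j"
  by (simp_all add: nf_def)

lemma pow_mod_eq: "x \<in> carrier G \<Longrightarrow> x [^] k = \<one> \<Longrightarrow> x [^] (i mod k) = x [^] i" for i k :: nat
  by (metis mult_div_mod_eq nat_pow_mult nat_pow_one nat_pow_pow l_one nat_pow_closed)

lemma nf_eq_iff: "nf i j = nf i' j' \<longleftrightarrow> [i = i'] (mod m) \<and> [j = j'] (mod n)"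
proof
  assume "[i = i'] (mod m) \<and> [j = j'] (mod n)"
  then have "a [^] i = a [^] i'" "b [^] j = b [^] j'"
    using pow_mod_eq[OF a a_pow] pow_mod_eq[OF b b_pow] unfolding cong_def by metis+
  then show "nf i j = nf i' j'" by (simp add: nf_def)
qed (use normal_form_unique in \<open>auto simp: nf_def\<close>)

lemma inv_generators: "inv a = nf (m - 1) 0" "inv b = nf 0 (n - 1)"
proof -
  have "a [^] (m - 1) \<otimes> a = \<one>" using m a_pow nat_pow_Suc[of a "m - 1"] by simp
  then show "inv a = nf (m - 1) 0" by (simp add: inv_equality flip: nf_a_pow)
  have "b [^] (n - 1) \<otimes> b = \<one>" using n b_pow nat_pow_Suc[of b "n - 1"] by simp
  then show "inv b = nf 0 (n - 1)" by (simp add: inv_equality flip: nf_b_pow)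
qed

lemma carrier_eq: "carrier G = {nf i j | i j. i < m \<and> j < n}"
proof -
  have "\<exists>i j. x = nf i j" if "x \<in> generate G {a, b}" for x
    using that
  proof induction
    case one
    show ?case by (metis nf_0_0)
  next
    case (incl x)
    then show ?case using nf_a_pow[of 1] nf_b_pow[of 1] by auto
  next
    case (inv x)
    then show ?case using inv_generators by auto
  next
    case (eng x y)
    then show ?case by (metis nf_mult)
  qed
  moreover have "nf i j = nf (i mod m) (j mod n)" for i j by (simp add: nf_eq_iff)
  moreover have "i mod m < m" "j mod n < n" for i j using m n by auto
  ultimately have "\<exists>i j. x = nf i j \<and> i < m \<and> j < n" if "x \<in> carrier G" for x
    using carrier_generate that by (metis subsetD)
  then show ?thesis by auto
qed

lemma carrierE:
  assumes "x \<in> carrier G"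
  obtains i j where "x = nf i j"
  using assms carrier_eq by auto

lemma finite_carrier: "finite (carrier G)"
proof -
  have "carrier G = (\<lambda>(i, j). nf i j) ` ({..<m} \<times> {..<n})" by (auto simp: carrier_eq)
  then show ?thesis by simp
qed

section \<open>The subgroups \<open>conj_H m1 n1 t\<close>\<close>

lemma r_pow_cong:
  assumes "[j = j'] (mod n)"
  shows "[int r ^ j = int r ^ j'] (mod int m)"
proof -
  have "[r ^ k = r ^ (k mod n)] (mod m)" for k
  proof -
    have "r ^ k = (r ^ n) ^ (k div n) * r ^ (k mod n)"
      by (simp flip: power_mult power_add)
    moreover have "[(r ^ n) ^ (k div n) * r ^ (k mod n) = 1 ^ (k div n) * r ^ (k mod n)] (mod m)"
      by (intro cong_mult cong_pow r cong_refl)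
    ultimately show ?thesis by simp
  qed
  from this[of j] this[of j'] have "[r ^ j = r ^ j'] (mod m)"
    using assms by (simp add: cong_def)
  then show ?thesis by (metis cong_int_iff of_nat_power)
qed

text \<open>The subgroup generated by \<open>a ^ m1\<close> and \<open>b ^ n1\<close>, conjugated by \<open>a ^ t\<close>.\<close>

definition conj_H :: "nat \<Rightarrow> nat \<Rightarrow> nat \<Rightarrow> 'a set" where
  "conj_H m1 n1 t = {nf i j | i j. n1 dvd j \<and> int m1 dvd int i + int t * (int r ^ j - 1)}"

text \<open>The condition is independent of the representatives: \<open>i\<close> is determined
  modulo \<open>m\<close>, a multiple of \<open>m1\<close>, and \<open>j\<close> modulo
  \<open>n\<close>, a multiple of \<open>n1\<close>, which by \<open>r_pow_cong\<close> fixes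
  \<open>r ^ j\<close> modulo \<open>m\<close>.\<close>

lemma nf_in_conj_H_iff:
  assumes m1: "m1 dvd m" and n1: "n1 dvd n"
  shows "nf i j \<in> conj_H m1 n1 t \<longleftrightarrow> n1 dvd j \<and> int m1 dvd int i + int t * (int r ^ j - 1)"
proof
  assume "nf i j \<in> conj_H m1 n1 t"
  then obtain i' j' where ij: "[i = i'] (mod m)" "[j = j'] (mod n)" and
    *: "n1 dvd j'" "int m1 dvd int i' + int t * (int r ^ j' - 1)"
    by (auto simp: conj_H_def nf_eq_iff)
  have "[j = j'] (mod n1)" using ij(2) n1 by (rule cong_dvd_modulus_nat)
  moreover have "[int i + int t * (int r ^ j - 1) = int i' + int t * (int r ^ j' - 1)] (mod int m)"
    using ij by (intro cong_add cong_mult cong_diff r_pow_cong cong_refl) (simp_all add: cong_int_iff)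
  then have "[int i + int t * (int r ^ j - 1) = int i' + int t * (int r ^ j' - 1)] (mod int m1)"
    by (rule cong_dvd_modulus) (use m1 in simp)
  ultimately show "n1 dvd j \<and> int m1 dvd int i + int t * (int r ^ j - 1)"
    using * by (metis cong_dvd_iff)
qed (auto simp: conj_H_def)

lemma conj_H_subset: "conj_H m1 n1 t \<subseteq> carrier G"
  by (auto simp: conj_H_def)

definition conj_a :: "nat \<Rightarrow> 'a \<Rightarrow> 'a" where
  "conj_a t x = inv (a [^] t) \<otimes> x \<otimes> a [^] t"

lemma conj_a_iso: "conj_a t \<in> iso G G"
proof -
  let ?c = "a [^] t"
  have "bij_betw (conj_a t) (carrier G) (carrier G)"
    by (rule bij_betw_byWitness[where f' = "\<lambda>x. ?c \<otimes> x \<otimes> inv ?c"])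
      (auto simp: conj_a_def m_assoc, auto simp flip: m_assoc)
  moreover have "conj_a t (x \<otimes> y) = conj_a t x \<otimes> conj_a t y"
    if "x \<in> carrier G" "y \<in> carrier G" for x y
  proof -
    have "?c \<otimes> (inv ?c \<otimes> z) = z" if "z \<in> carrier G" for z
      using that by (simp flip: m_assoc)
    then show ?thesis using that by (simp add: conj_a_def m_assoc)
  qed
  ultimately show ?thesis by (auto simp: iso_def hom_def conj_a_def)
qed

text \<open>The summand \<open>(m - 1) * t * r ^ j\<close> stands for \<open>- t * r ^ j\<close> modulo \<open>m\<close>.\<close>

lemma conj_a_nf: "conj_a t (nf i j) = nf (i + t + (m - 1) * t * r ^ j) j"
proof -
  have eq: "t * r ^ j + (i + t + (m - 1) * t * r ^ j) = (1 + (m - 1)) * t * r ^ j + (i + t)"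
    by (simp add: algebra_simps)
  have "1 + (m - 1) = m" using m by simp
  then have "a [^] t \<otimes> nf (i + t + (m - 1) * t * r ^ j) j = nf i j \<otimes> a [^] t"
    unfolding nf_a_pow nf_mult nf_eq_iff add_0 power_0 mult_1_right add_0_right eq
    by (simp add: cong_def mult.assoc)
  then have "inv (a [^] t) \<otimes> (nf i j \<otimes> a [^] t) =
      inv (a [^] t) \<otimes> (a [^] t \<otimes> nf (i + t + (m - 1) * t * r ^ j) j)"
    by simp
  also have "\<dots> = nf (i + t + (m - 1) * t * r ^ j) j" by (simp add: m_assoc[symmetric])
  finally show ?thesis by (simp add: conj_a_def m_assoc)
qed

text \<open>Conjugation by \<open>a ^ t\<close> keeps \<open>j\<close> and subtracts
  \<open>t * (r ^ j - 1)\<close> from \<open>i\<close>, so \<open>m1 dvd i\<close> becomes the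
  condition that defines \<open>conj_H m1 n1 t\<close>.\<close>

lemma conj_H_eq_image:
  assumes m1: "m1 dvd m" and n1: "n1 dvd n"
  shows "conj_H m1 n1 t = conj_a t ` conj_H m1 n1 0"
proof (intro equalityI subsetI)
  have dvd_m: "int m1 dvd int m * x" for x using m1 by simp
  have int_m: "int (m - 1) = int m - 1" using m by (simp add: of_nat_diff)
  {
    fix x assume "x \<in> conj_H m1 n1 t"
    then obtain i j where x: "x = nf i j" and ij: "n1 dvd j" "int m1 dvd int i + int t * (int r ^ j - 1)"
      by (auto simp: conj_H_def)
    \<comment> \<open>Modulo \<open>m\<close> this is \<open>i + t * (r ^ j - 1)\<close>, the
      exponent before conjugation.\<close>
    let ?i = "i + t * r ^ j + (m - 1) * t"
    have "int ?i = (int i + int t * (int r ^ j - 1)) + int m * int t"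
      unfolding of_nat_add of_nat_mult of_nat_power int_m by (simp add: algebra_simps)
    then have "int m1 dvd int ?i" using ij(2) dvd_m by (metis dvd_add)
    then have "nf ?i j \<in> conj_H m1 n1 0" using ij unfolding conj_H_def by fastforce
    moreover have "conj_a t (nf ?i j) = x"
    proof -
      have "?i + t + (m - 1) * t * r ^ j = i + (1 + (m - 1)) * (t * r ^ j + t)"
        by (simp add: algebra_simps)
      also have "1 + (m - 1) = m" using m by simp
      finally have "?i + t + (m - 1) * t * r ^ j = i + m * (t * r ^ j + t)" .
      then show ?thesis unfolding conj_a_nf x nf_eq_iff cong_def by (simp only: mod_mult_self2)
    qed
    ultimately show "x \<in> conj_a t ` conj_H m1 n1 0" by blast
  next
    fix x assume "x \<in> conj_a t ` conj_H m1 n1 0"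
    then obtain i j where x: "x = nf (i + t + (m - 1) * t * r ^ j) j" and ij: "n1 dvd j" "int m1 dvd int i"
      by (auto simp: conj_H_def conj_a_nf)
    have "int (i + t + (m - 1) * t * r ^ j) + int t * (int r ^ j - 1) = int i + int m * (int t * int r ^ j)"
      unfolding of_nat_add of_nat_mult of_nat_power int_m by (simp add: algebra_simps)
    then have "int m1 dvd int (i + t + (m - 1) * t * r ^ j) + int t * (int r ^ j - 1)"
      using ij(2) dvd_m by (metis dvd_add)
    then show "x \<in> conj_H m1 n1 t" using x ij unfolding conj_H_def by blast
  }
qed

text \<open>The quantity \<open>i + t * (r ^ j - 1)\<close> is a crossed homomorphism: for a
  product, the value at the left factor is multiplied by \<open>r ^ j'\<close> and added to the
  value at the right factor.\<close>

lemma subgroup_conj_H: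
  assumes m1: "m1 dvd m" and n1: "n1 dvd n"
  shows "subgroup (conj_H m1 n1 t) G"
proof (rule finite_subgroupI[OF finite_carrier conj_H_subset])
  show "conj_H m1 n1 t \<noteq> {}" using nf_in_conj_H_iff[OF m1 n1, of 0 0] by auto
next
  fix x y assume "x \<in> conj_H m1 n1 t" "y \<in> conj_H m1 n1 t"
  then obtain i j i' j' where xy: "x = nf i j" "y = nf i' j'"
    and d: "n1 dvd j" "int m1 dvd int i + int t * (int r ^ j - 1)"
      "n1 dvd j'" "int m1 dvd int i' + int t * (int r ^ j' - 1)"
    unfolding conj_H_def by blast
  have "int (i * r ^ j' + i') + int t * (int r ^ (j + j') - 1)
    = (int i + int t * (int r ^ j - 1)) * int r ^ j' + (int i' + int t * (int r ^ j' - 1))"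
    by (simp add: algebra_simps power_add)
  then have "int m1 dvd int (i * r ^ j' + i') + int t * (int r ^ (j + j') - 1)"
    using d(2,4) by (simp only: dvd_add dvd_mult2)
  then show "x \<otimes> y \<in> conj_H m1 n1 t"
    unfolding xy nf_mult nf_in_conj_H_iff[OF m1 n1] using d(1,3) dvd_add by blast
qed

lemma generate_eq_conj_H:
  assumes m1: "m1 dvd m" and n1: "n1 dvd n"
  shows "generate G {a [^] m1, b [^] n1} = conj_H m1 n1 0"
proof
  show "generate G {a [^] m1, b [^] n1} \<subseteq> conj_H m1 n1 0"
  proof (rule generate_subgroup_incl[OF _ subgroup_conj_H[OF m1 n1]])
    show "{a [^] m1, b [^] n1} \<subseteq> conj_H m1 n1 0"
      unfolding nf_a_pow nf_b_pow by (simp add: nf_in_conj_H_iff[OF m1 n1])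
  qed
next
  have S: "subgroup (generate G {a [^] m1, b [^] n1}) G" by (intro generate_is_subgroup) simp
  have pow: "x [^] k \<in> generate G {a [^] m1, b [^] n1}" if "x \<in> {a [^] m1, b [^] n1}" for x and k :: nat
  proof -
    have "x \<in> generate G {a [^] m1, b [^] n1}" by (rule generate.incl[OF that])
    then show ?thesis
      by (induction k) (simp_all add: subgroup.m_closed[OF S] subgroup.one_closed[OF S])
  qed
  show "conj_H m1 n1 0 \<subseteq> generate G {a [^] m1, b [^] n1}"
  proof
    fix x assume "x \<in> conj_H m1 n1 0"
    then obtain i j where "x = nf i j" "m1 dvd i" "n1 dvd j" by (auto simp: conj_H_def)
    then obtain i j where "x = nf (m1 * i) (n1 * j)" by (elim dvdE) simp
    then have "x = (b [^] n1) [^] j \<otimes> (a [^] m1) [^] i" by (simp add: nf_def nat_pow_pow)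
    then show "x \<in> generate G {a [^] m1, b [^] n1}"
      by (auto intro!: subgroup.m_closed[OF S] pow)
  qed
qed

end

section \<open>Number of conjugates and classification of all subgroups\<close>

text \<open>The sum is congruent to \<open>k\<close> modulo \<open>y - 1\<close>, so a common
  divisor of \<open>x\<close>, \<open>y - 1\<close> and the sum divides \<open>k\<close> and is a
  unit. Hence the two gcds are coprime and their product divides \<open>x\<close>. In the other
  direction, \<open>x\<close> divides \<open>(y - 1)\<close> times the sum and splits
  accordingly.\<close>

lemma gcd_geometric_mult:
  fixes x y :: int
  assumes x: "x \<ge> 0" and dvd: "x dvd y ^ k - 1" and cop: "coprime x (int k)"
  shows "gcd x (\<Sum>i<k. y ^ i) * gcd x (y - 1) = x"
proof -
  let ?S = "\<Sum>i<k. y ^ i"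
  have eq: "y ^ k - 1 = (y - 1) * ?S" by (rule power_diff_1_eq)
  have "[?S = (\<Sum>i<k. 1 ^ i)] (mod (y - 1))"
    by (intro cong_sum cong_pow) (simp add: cong_iff_dvd_diff)
  then have S: "y - 1 dvd ?S - int k" by (simp add: cong_iff_dvd_diff)
  have "coprime (gcd x ?S) (gcd x (y - 1))"
  proof (rule coprimeI)
    fix c assume c: "c dvd gcd x ?S" "c dvd gcd x (y - 1)"
    then have "c dvd ?S" "c dvd ?S - int k" using S by (auto intro: dvd_trans)
    then have "c dvd ?S - (?S - int k)" by (rule dvd_diff)
    then show "is_unit c" using c cop by (simp add: coprime_def)
  qed
  then have 1: "gcd x ?S * gcd x (y - 1) dvd x" by (intro divides_mult) auto
  have "x dvd ?S * (y - 1)" using dvd by (simp add: eq mult.commute)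
  then obtain u v where "x = u * v" "u dvd ?S" "v dvd y - 1" using division_decomp by blast
  then have 2: "x dvd gcd x ?S * gcd x (y - 1)" by (metis dvd_triv_left dvd_triv_right gcd_greatest mult_dvd_mono)
  show ?thesis using zdvd_antisym_nonneg[OF _ x 1 2] by simp
qed

text \<open>The geometric sum treats uniformly the exceptional value at \<open>r = 1\<close>, the
  divisor -1 at \<open>r = 0\<close> and the exact division for larger \<open>r\<close>.\<close>

lemma zm_quot_eq_sum:
  assumes "n > 0" "k dvd n"
  shows "zm_quot r n k = (\<Sum>i<n div k. (int r ^ k) ^ i)"
proof (cases "r = 1")
  case False
  have k: "k > 0" using assms by (auto intro: Nat.gr0I)
  then have "int r ^ k \<noteq> 1" using False by (cases "r = 0") (auto simp: power_0_left simp flip: of_nat_power)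
  moreover have "int r ^ n - 1 = (int r ^ k - 1) * (\<Sum>i<n div k. (int r ^ k) ^ i)"
  proof -
    have "int r ^ n - 1 = (int r ^ k) ^ (n div k) - 1" using assms by (simp flip: power_mult)
    also have "\<dots> = (int r ^ k - 1) * (\<Sum>i<n div k. (int r ^ k) ^ i)" by (rule power_diff_1_eq)
    finally show ?thesis .
  qed
  ultimately show ?thesis using False by (simp add: zm_quot_def)
qed (simp add: zm_quot_def)

context metacyclic
begin

lemma dvd_pos: "m1 dvd m \<Longrightarrow> m1 > 0" "n1 dvd n \<Longrightarrow> n1 > 0"
  using m n by (auto intro: Nat.gr0I)

text \<open>The shifts \<open>t < num_conj m1 n1\<close> index without repetition the subgroups with
  parameters \<open>m1\<close> and \<open>n1\<close>; this is why the gcd occurs as a multiplicity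
  in the formula.\<close>

definition num_conj :: "nat \<Rightarrow> nat \<Rightarrow> nat" where
  "num_conj m1 n1 = nat (gcd (int m1) (zm_quot r n n1))"

lemma int_num_conj: "int (num_conj m1 n1) = gcd (int m1) (zm_quot r n n1)"
  by (simp add: num_conj_def)

lemma num_conj_mult:
  assumes m1: "m1 dvd m" and n1: "n1 dvd n"
  shows "int (num_conj m1 n1) * gcd (int m1) (int r ^ n1 - 1) = int m1"
proof -
  have "(int r ^ n1) ^ (n div n1) = int r ^ n" using n1 by (simp flip: power_mult)
  moreover have "[int r ^ n = 1] (mod int m)" using r by (metis cong_int_iff of_nat_1 of_nat_power)
  then have "int m1 dvd int r ^ n - 1" using m1
    by (metis cong_iff_dvd_diff dvd_trans of_nat_dvd_iff)
  moreover have "n div n1 dvd n" using n1 by (metis dvd_div_mult_self dvd_triv_left)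
  then have "coprime m1 (n div n1)" by (rule coprime_divisors[OF m1 _ coprime])
  ultimately show ?thesis
    using gcd_geometric_mult[of "int m1" "int r ^ n1" "n div n1"]
    by (simp add: int_num_conj zm_quot_eq_sum n n1)
qed

lemma num_conj_pos: "m1 dvd m \<Longrightarrow> num_conj m1 n1 > 0"
  using dvd_pos by (simp add: num_conj_def)

lemma exists_nf_in_conj_H_iff:
  assumes m1: "m1 dvd m" and n1: "n1 dvd n"
  shows "(\<exists>i. nf i j \<in> conj_H m1 n1 t) \<longleftrightarrow> n1 dvd j"
proof
  assume j: "n1 dvd j"
  define z where "z = int t * (int r ^ j - 1)"
  have "int m1 > 0" using dvd_pos(1)[OF m1] by simp
  then have i: "int (nat ((- z) mod int m1)) = (- z) mod int m1" by simp
  have "int m1 dvd (- z) mod int m1 + z"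
    by (metis add.left_inverse dvd_0_right mod_0_imp_dvd mod_add_left_eq mod_0)
  then have "nf (nat ((- z) mod int m1)) j \<in> conj_H m1 n1 t"
    unfolding nf_in_conj_H_iff[OF m1 n1] z_def[symmetric] i using j by blast
  then show "\<exists>i. nf i j \<in> conj_H m1 n1 t" ..
qed (auto simp: nf_in_conj_H_iff[OF m1 n1])

text \<open>The elements with \<open>j = 0\<close> reveal \<open>m1\<close>, and the values of
  \<open>j\<close> that occur reveal \<open>n1\<close>. A common element with \<open>j = n1\<close>
  then fixes \<open>t * (r ^ n1 - 1)\<close> modulo \<open>m1\<close>, hence \<open>t\<close> modulo
  \<open>m1 / gcd(m1, r ^ n1 - 1)\<close>, which is \<open>num_conj m1 n1\<close>.\<close>

lemma conj_H_unique:
  assumes m1: "m1 dvd m" and n1: "n1 dvd n" and t: "t < num_conj m1 n1"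
    and m1': "m1' dvd m" and n1': "n1' dvd n" and t': "t' < num_conj m1' n1'"
    and eq: "conj_H m1 n1 t = conj_H m1' n1' t'"
  shows "m1 = m1' \<and> n1 = n1' \<and> t = t'"
proof -
  have "m1 dvd i \<longleftrightarrow> m1' dvd i" for i
    using nf_in_conj_H_iff[OF m1 n1, of i 0 t] nf_in_conj_H_iff[OF m1' n1', of i 0 t'] eq by simp
  from this[of m1] this[of m1'] have m: "m1' = m1" by (simp add: dvd_antisym)
  have "n1 dvd j \<longleftrightarrow> n1' dvd j" for j
    using exists_nf_in_conj_H_iff[OF m1 n1, of j t] exists_nf_in_conj_H_iff[OF m1' n1', of j t'] eq
    by simp
  from this[of n1] this[of n1'] have n: "n1' = n1" by (simp add: dvd_antisym)
  define d e where "d = int (num_conj m1 n1)" and "e = gcd (int m1) (int r ^ n1 - 1)"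
  obtain i where "nf i n1 \<in> conj_H m1 n1 t" using exists_nf_in_conj_H_iff[OF m1 n1, of n1 t] by auto
  moreover from this have "nf i n1 \<in> conj_H m1 n1 t'" by (simp add: eq m n)
  ultimately have "int m1 dvd (int i + int t * (int r ^ n1 - 1)) - (int i + int t' * (int r ^ n1 - 1))"
    by (intro dvd_diff) (simp_all add: nf_in_conj_H_iff[OF m1 n1])
  then have dvd: "int m1 dvd (int t - int t') * (int r ^ n1 - 1)" by (simp add: algebra_simps)
  have de: "d * e = int m1" unfolding d_def e_def by (rule num_conj_mult[OF m1 n1])
  have e: "e \<noteq> 0" using dvd_pos(1)[OF m1] by (simp add: e_def)
  obtain d' f where d': "int m1 = d' * e" and f: "int r ^ n1 - 1 = f * e" and cop: "coprime d' f"
    using gcd_coprime_exists[of "int m1" "int r ^ n1 - 1"] e unfolding e_def by blast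
  have "d' = d" using d' e by (simp flip: de)
  have "d * e dvd ((int t - int t') * f) * e" using dvd by (simp add: de f mult.assoc)
  then have "d dvd (int t - int t') * f" using e by simp
  then have "d dvd int t - int t'" using cop by (simp add: \<open>d' = d\<close> coprime_dvd_mult_left_iff)
  then have "[t = t'] (mod num_conj m1 n1)" unfolding d_def by (metis cong_iff_dvd_diff cong_int_iff)
  then show ?thesis using t t' m n by (simp add: cong_less_modulus_unique_nat)
qed

lemma nf_pow: "nf s n1 [^] k = nf (s * (\<Sum>i<k. (r ^ n1) ^ i)) (n1 * k)" for k :: nat
proof (induction k)
  case (Suc k)
  have "(\<Sum>i<Suc k. (r ^ n1) ^ i) = (\<Sum>i<k. (r ^ n1) ^ i) * r ^ n1 + 1"
    by (simp add: sum.lessThan_Suc_shift sum_distrib_left mult.commute del: sum.lessThan_Suc)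
  then show ?case by (simp add: Suc nf_mult algebra_simps)
qed simp

text \<open>The powers of \<open>a\<close> in \<open>H\<close> give \<open>m1\<close>, the occurring
  exponents of \<open>b\<close> give \<open>n1\<close>, and these together with a single element
  \<open>nf s n1\<close> determine \<open>H\<close>. The shift \<open>t\<close> is chosen so that
  \<open>conj_H m1 n1 t\<close> contains that element.\<close>

lemma subgroup_eq_conj_H:
  assumes H: "subgroup H G"
  obtains m1 n1 t where "m1 dvd m" "n1 dvd n" "t < num_conj m1 n1" "H = conj_H m1 n1 t"
proof -
  have one: "nf m 0 \<in> H" "nf 0 n \<in> H"
    using subgroup.one_closed[OF H] nf_eq_iff[of m 0 0 0] nf_eq_iff[of 0 n 0 0]
    by (simp_all add: cong_def)
  obtain m1 where m1: "m1 dvd m" and A: "\<And>i. nf i 0 \<in> H \<longleftrightarrow> m1 dvd i"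
  proof (rule nat_ideal_principal[of m "{i. nf i 0 \<in> H}"])
    show "i + j \<in> {i. nf i 0 \<in> H}" if "i \<in> {i. nf i 0 \<in> H}" "j \<in> {i. nf i 0 \<in> H}" for i j
      using that subgroup.m_closed[OF H, of "nf i 0" "nf j 0"] by (simp add: nf_mult)
    show "j \<in> {i. nf i 0 \<in> H}" if "i \<in> {i. nf i 0 \<in> H}" "[i = j] (mod m)" for i j
      using that nf_eq_iff[of i 0 j 0] by simp
  qed (use m one in auto)
  obtain n1 where n1: "n1 dvd n" and B: "\<And>j. (\<exists>i. nf i j \<in> H) \<longleftrightarrow> n1 dvd j"
  proof (rule nat_ideal_principal[of n "{j. \<exists>i. nf i j \<in> H}"])
    show "i + j \<in> {j. \<exists>i. nf i j \<in> H}"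
      if "i \<in> {j. \<exists>i. nf i j \<in> H}" "j \<in> {j. \<exists>i. nf i j \<in> H}" for i j
    proof -
      from that obtain k l where "nf k i \<in> H" "nf l j \<in> H" by blast
      from subgroup.m_closed[OF H this] show ?thesis by (auto simp: nf_mult)
    qed
    show "j \<in> {j. \<exists>i. nf i j \<in> H}"
      if "i \<in> {j. \<exists>i. nf i j \<in> H}" "[i = j] (mod n)" for i j
    proof -
      from that(1) obtain k where "nf k i \<in> H" by blast
      moreover have "nf k i = nf k j" using that(2) by (simp add: nf_eq_iff)
      ultimately show ?thesis by auto
    qed
  qed (use n one in auto)
  obtain s where s: "nf s n1 \<in> H" using B[of n1] by auto
  let ?R = "int r ^ n1" and ?S = "\<lambda>k. \<Sum>i<k. (r ^ n1) ^ i"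
  have int_S: "int (?S k) = (\<Sum>i<k. ?R ^ i)" for k by simp
  \<comment> \<open>Dividing by the \<open>k\<close>-th power \<open>?y\<close> of the chosen
    element leaves the power of \<open>a\<close> with exponent \<open>?i\<close>, to which
    \<open>A\<close> applies.\<close>
  have mem: "nf i (n1 * k) \<in> H \<longleftrightarrow> int m1 dvd int i - int s * int (?S k)" for i k
  proof -
    let ?y = "nf (s * ?S k) (n1 * k)" and ?i = "i + (m - 1) * (s * ?S k)"
    have "nf s n1 [^] k \<in> H"
      by (induction k) (simp_all add: s subgroup.one_closed[OF H] subgroup.m_closed[OF H])
    then have y: "?y \<in> H" by (simp only: nf_pow)
    have "s * ?S k + ?i = i + (1 + (m - 1)) * (s * ?S k)" by (simp only: distrib_right mult_1 add.assoc add.left_commute)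
    also have "1 + (m - 1) = m" using m by simp
    finally have yz: "?y \<otimes> nf ?i 0 = nf i (n1 * k)"
      unfolding nf_mult nf_eq_iff cong_def power_0 mult_1_right by (simp only: mod_mult_self2 add_0_right)
    have "?y \<otimes> nf ?i 0 \<in> H \<longleftrightarrow> nf ?i 0 \<in> H"
    proof
      assume "?y \<otimes> nf ?i 0 \<in> H"
      then have "inv ?y \<otimes> (?y \<otimes> nf ?i 0) \<in> H"
        by (rule subgroup.m_closed[OF H subgroup.m_inv_closed[OF H y]])
      moreover have "inv ?y \<otimes> (?y \<otimes> nf ?i 0) = nf ?i 0"
        by (simp flip: m_assoc)
      ultimately show "nf ?i 0 \<in> H" by simp
    qed (rule subgroup.m_closed[OF H y])
    then have "nf i (n1 * k) \<in> H \<longleftrightarrow> int m1 dvd int ?i" unfolding yz A of_nat_dvd_iff .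
    moreover have "int (m - 1) = int m - 1" using m by (simp add: of_nat_diff)
    then have "int ?i = (int i - int s * int (?S k)) + int m * (int s * int (?S k))"
      unfolding of_nat_add of_nat_mult by (simp only:) (simp add: algebra_simps del: of_nat_sum)
    moreover have "int m1 dvd (int i - int s * int (?S k)) + int m * (int s * int (?S k))
        \<longleftrightarrow> int m1 dvd int i - int s * int (?S k)"
      using m1 by (intro dvd_add_left_iff) simp
    ultimately show ?thesis by (simp only:)
  qed
  define d e where "d = int (num_conj m1 n1)" and "e = gcd (int m1) (?R - 1)"
  have de: "d * e = int m1" unfolding d_def e_def by (rule num_conj_mult[OF m1 n1])
  have d: "d > 0" using num_conj_pos[OF m1] by (simp add: d_def)
  \<comment> \<open>The identity, written as \<open>nf 0 n\<close>, is the case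
    \<open>i = 0\<close>, \<open>k = n div n1\<close> of \<open>mem\<close>. Cancelling
    \<open>d\<close>, the gcd of \<open>m1\<close> and the quotient, then gives that
    \<open>e\<close> divides \<open>s\<close>.\<close>
  have "int m1 dvd int s * zm_quot r n n1"
    using mem[of 0 "n div n1"] one n1 by (simp add: zm_quot_eq_sum[OF n n1])
  moreover obtain e' q' where e': "int m1 = e' * d" and q': "zm_quot r n n1 = q' * d"
    and cop: "coprime e' q'"
    using gcd_coprime_exists[of "int m1" "zm_quot r n n1"] d unfolding d_def int_num_conj by auto
  moreover have "e' = e" using e' d by (simp flip: de)
  ultimately have "e * d dvd (int s * q') * d" by (simp add: mult.assoc)
  then have "e dvd int s * q'" using d by simp
  then have "e dvd int s" using cop by (simp add: \<open>e' = e\<close> coprime_dvd_mult_left_iff)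
  then have "gcd (?R - 1) (int m1) dvd - int s" by (simp add: e_def gcd.commute)
  then obtain x where x: "[(?R - 1) * x = - int s] (mod int m1)"
    using cong_solve_dvd_int by blast
  \<comment> \<open>Reducing the solution \<open>x\<close> modulo \<open>d\<close> keeps it a
    solution: \<open>d * (?R - 1)\<close> is a multiple of \<open>d * e = m1\<close>.\<close>
  define t where "t = nat (x mod d)"
  have t: "int t = x mod d" using d by (simp add: t_def)
  have "int t < d" using d by (simp add: t)
  then have "t < num_conj m1 n1" by (simp add: d_def)
  have "d dvd int t - x" by (simp add: t mod_eq_dvd_iff[symmetric])
  moreover have "e dvd ?R - 1" by (simp add: e_def)
  ultimately have "d * e dvd (int t - x) * (?R - 1)" by (rule mult_dvd_mono)
  moreover have "int m1 dvd (?R - 1) * x - (- int s)" using x by (simp add: cong_iff_dvd_diff)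
  ultimately have "int m1 dvd (int t - x) * (?R - 1) + ((?R - 1) * x - (- int s))"
    unfolding de by (rule dvd_add)
  then have st: "int m1 dvd int s + int t * (?R - 1)" by (simp add: algebra_simps)
  have "nf i j \<in> H \<longleftrightarrow> nf i j \<in> conj_H m1 n1 t" for i j
  proof (cases "n1 dvd j")
    case True
    then obtain k where k: "j = n1 * k" by blast
    have eq: "?R ^ k - 1 = (?R - 1) * int (?S k)" unfolding int_S by (rule power_diff_1_eq)
    \<comment> \<open>With \<open>r ^ j - 1 = (?R - 1) * ?S k\<close>, the two membership conditions
      differ by a multiple of \<open>s + t * (?R - 1)\<close>, which \<open>m1\<close> divides by
      the choice of \<open>t\<close>.\<close>
    have "int i + int t * (int r ^ j - 1) =
        (int i - int s * int (?S k)) + int (?S k) * (int s + int t * (?R - 1))"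
      unfolding k power_mult eq by (simp add: algebra_simps del: of_nat_sum)
    moreover have "int m1 dvd \<dots> \<longleftrightarrow> int m1 dvd int i - int s * int (?S k)"
      using st by (intro dvd_add_left_iff dvd_mult)
    ultimately show ?thesis using mem[of i k] True by (simp only: nf_in_conj_H_iff[OF m1 n1] k) simp
  next
    case False
    then show ?thesis using B[of j] by (auto simp: nf_in_conj_H_iff[OF m1 n1])
  qed
  then have "H = conj_H m1 n1 t"
    using subgroup.subset[OF H] conj_H_subset[of m1 n1 t] by (blast elim: carrierE)
  then show thesis using that m1 n1 \<open>t < num_conj m1 n1\<close> by blast
qed

lemma sum_subgroups:
  "(\<Sum>L | subgroup L G. f L) =
    (\<Sum>m1 | m1 dvd m. \<Sum>n1 | n1 dvd n. \<Sum>t<num_conj m1 n1. f (conj_H m1 n1 t))"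
proof -
  let ?I = "Sigma {m1. m1 dvd m} (\<lambda>m1. Sigma {n1. n1 dvd n} (\<lambda>n1. {..<num_conj m1 n1}))"
  have "bij_betw (\<lambda>(m1, n1, t). conj_H m1 n1 t) ?I {L. subgroup L G}"
    unfolding bij_betw_def
  proof
    show "inj_on (\<lambda>(m1, n1, t). conj_H m1 n1 t) ?I"
      using conj_H_unique by (auto simp: inj_on_def)
    show "(\<lambda>(m1, n1, t). conj_H m1 n1 t) ` ?I = {L. subgroup L G}"
    proof (intro equalityI subsetI)
      fix L assume "L \<in> {L. subgroup L G}"
      then obtain m1 n1 t where "m1 dvd m" "n1 dvd n" "t < num_conj m1 n1" "L = conj_H m1 n1 t"
        using subgroup_eq_conj_H by blast
      then show "L \<in> (\<lambda>(m1, n1, t). conj_H m1 n1 t) ` ?I"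
        by (intro image_eqI[of _ _ "(m1, n1, t)"]) auto
    qed (auto intro: subgroup_conj_H)
  qed
  then have "(\<Sum>L | subgroup L G. f L) = (\<Sum>(m1, n1, t)\<in>?I. f (conj_H m1 n1 t))"
    by (subst sum.reindex_bij_betw[symmetric]) (auto simp: case_prod_unfold)
  also have "\<dots> = (\<Sum>m1 | m1 dvd m. \<Sum>n1 | n1 dvd n. \<Sum>t<num_conj m1 n1. f (conj_H m1 n1 t))"
    using m n by (simp add: sum.Sigma case_prod_unfold)
  finally show ?thesis .
qed

section \<open>Counting cyclic subgroups and permuting pairs\<close>

text \<open>The divisibility says that \<open>a ^ m1\<close> and \<open>b ^ n1\<close> commute, as
  they must in a cyclic group. If they commute, the coprimality of \<open>m\<close> and
  \<open>n\<close> makes \<open>nf m1 n1\<close> a generator: by the Chinese remainder theorem one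
  exponent realises any two prescribed ones. Conjugation carries this from \<open>t = 0\<close> to
  every \<open>t\<close>.\<close>

lemma conj_H_cyclic_iff:
  assumes m1: "m1 dvd m" and n1: "n1 dvd n"
  shows "conj_H m1 n1 t \<in> cyclic_subgroups G \<longleftrightarrow> int (m div m1) dvd int r ^ n1 - 1"
proof -
  have m_eq: "m1 * (m div m1) = m" using m1 by simp
  have "int m dvd int m1 * (int r ^ n1 - 1) \<longleftrightarrow> int m1 * int (m div m1) dvd int m1 * (int r ^ n1 - 1)"
    by (metis m_eq of_nat_mult)
  also have "\<dots> \<longleftrightarrow> int (m div m1) dvd int r ^ n1 - 1" using dvd_pos(1)[OF m1] by simp
  finally have dvd_iff: "int m dvd int m1 * (int r ^ n1 - 1) \<longleftrightarrow> int (m div m1) dvd int r ^ n1 - 1" .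
  have cong_iff: "[m1 * r ^ n1 = m1] (mod m) \<longleftrightarrow> int (m div m1) dvd int r ^ n1 - 1"
    unfolding dvd_iff[symmetric] cong_int_iff[symmetric] cong_iff_dvd_diff by (simp add: algebra_simps)
  have "conj_H m1 n1 0 \<in> cyclic_subgroups G \<longleftrightarrow> [m1 * r ^ n1 = m1] (mod m)"
  proof
    assume "conj_H m1 n1 0 \<in> cyclic_subgroups G"
    then have "comm_group (G\<lparr>carrier := conj_H m1 n1 0\<rparr>)"
      by (auto simp: cyclic_subgroups_def intro: group.cyclic_imp_abelian_group subgroup_imp_group)
    moreover have "nf m1 0 \<in> conj_H m1 n1 0" "nf 0 n1 \<in> conj_H m1 n1 0"
      by (simp_all add: nf_in_conj_H_iff[OF m1 n1])
    ultimately have "nf m1 0 \<otimes> nf 0 n1 = nf 0 n1 \<otimes> nf m1 0"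
      using comm_groupE(4)[of "G\<lparr>carrier := conj_H m1 n1 0\<rparr>"] by simp
    then show "[m1 * r ^ n1 = m1] (mod m)" by (simp add: nf_mult nf_eq_iff)
  next
    assume c: "[m1 * r ^ n1 = m1] (mod m)"
    have pow: "nf m1 n1 [^] k = nf (m1 * k) (n1 * k)" for k :: nat
    proof (induction k)
      case (Suc k)
      have "[(m1 * r ^ n1) * k + m1 = m1 * k + m1] (mod m)" by (intro cong_add cong_mult c cong_refl)
      then show ?case by (simp add: Suc nf_mult nf_eq_iff ac_simps)
    qed simp
    have S: "subgroup (generate G {nf m1 n1}) G" by (intro generate_is_subgroup) simp
    have "conj_H m1 n1 0 = generate G {nf m1 n1}"
    proof
      show "generate G {nf m1 n1} \<subseteq> conj_H m1 n1 0"
        by (rule generate_subgroup_incl[OF _ subgroup_conj_H[OF m1 n1]])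
          (simp add: nf_in_conj_H_iff[OF m1 n1])
      show "conj_H m1 n1 0 \<subseteq> generate G {nf m1 n1}"
      proof
        fix x assume "x \<in> conj_H m1 n1 0"
        then obtain i j where "x = nf i j" "m1 dvd i" "n1 dvd j" by (auto simp: conj_H_def)
        then obtain i j where x: "x = nf (m1 * i) (n1 * j)" by (elim dvdE) simp
        obtain k where k: "[k = i] (mod m)" "[k = j] (mod n)"
          using binary_chinese_remainder_nat[OF coprime] by blast
        have "x = nf m1 n1 [^] k"
          unfolding pow x nf_eq_iff using k by (auto intro: cong_mult cong_sym)
        also have "\<dots> \<in> generate G {nf m1 n1}"
          by (induction k) (auto intro: subgroup.m_closed[OF S] subgroup.one_closed[OF S] generate.incl)
        finally show "x \<in> generate G {nf m1 n1}" .
      qed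
    qed
    then show "conj_H m1 n1 0 \<in> cyclic_subgroups G" by (auto simp: cyclic_subgroups_eq)
  qed
  then show ?thesis
    by (simp add: conj_H_eq_image[OF m1 n1, of t] cong_iff
        iso_image_cyclic_subgroup_iff[OF conj_a_iso conj_H_subset])
qed

lemma card_cyclic_subgroups:
  "card (cyclic_subgroups G) =
    (\<Sum>m1 | m1 dvd m. \<Sum>n1 | n1 dvd n \<and> int (m div m1) dvd int r ^ n1 - 1. num_conj m1 n1)"
proof -
  have "finite {L. subgroup L G}"
    by (rule finite_subset[of _ "Pow (carrier G)"]) (use finite_carrier in \<open>auto dest: subgroup.subset\<close>)
  then have "(\<Sum>L | subgroup L G. if L \<in> cyclic_subgroups G then 1 else 0)
      = card ({L. subgroup L G} \<inter> cyclic_subgroups G)"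
    by (simp add: sum.inter_restrict[symmetric])
  also have "{L. subgroup L G} \<inter> cyclic_subgroups G = cyclic_subgroups G"
    by (auto simp: cyclic_subgroups_def)
  finally have "card (cyclic_subgroups G) = (\<Sum>m1 | m1 dvd m. \<Sum>n1 | n1 dvd n. \<Sum>t<num_conj m1 n1.
      if conj_H m1 n1 t \<in> cyclic_subgroups G then 1 else 0)"
    by (simp only: sum_subgroups)
  also have "\<dots> = (\<Sum>m1 | m1 dvd m. \<Sum>n1 | n1 dvd n.
      if int (m div m1) dvd int r ^ n1 - 1 then num_conj m1 n1 else 0)"
    \<comment> \<open>Cyclicity does not depend on \<open>t\<close>, so each inner sum is
      \<open>num_conj m1 n1\<close> or zero.\<close>
    by (intro sum.cong HOL.refl) (simp add: conj_H_cyclic_iff)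
  also have "\<dots> = (\<Sum>m1 | m1 dvd m. \<Sum>n1 | n1 dvd n \<and> int (m div m1) dvd int r ^ n1 - 1. num_conj m1 n1)"
    using n sum.inter_filter[of "{n1. n1 dvd n}", symmetric]
    by (intro sum.cong[OF HOL.refl]) simp
  finally show ?thesis .
qed

lemma card_permutable_pairs:
  "card {(H, K). H \<in> cyclic_subgroups G \<and> K \<in> cyclic_subgroups G \<and> H <#> K = K <#> H}
    = (\<Sum>m1 | m1 dvd m. \<Sum>n1 | n1 dvd n.
        num_conj m1 n1 * CF2 (subgroup_generated G {a [^] m1, b [^] n1}))"
proof -
  have "card (cyclic_factorizations G (conj_H m1 n1 t)) = CF2 (subgroup_generated G {a [^] m1, b [^] n1})"
    if m1: "m1 dvd m" and n1: "n1 dvd n" for m1 n1 t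
  proof -
    have "subgroup_generated G {a [^] m1, b [^] n1} = G\<lparr>carrier := conj_H m1 n1 0\<rparr>"
      by (simp add: subgroup_generated_def flip: generate_eq_conj_H[OF m1 n1])
    then show ?thesis
      by (simp add: conj_H_eq_image[OF m1 n1, of t] CF2_restrict[OF subgroup_conj_H[OF m1 n1]]
          card_cyclic_factorizations_iso[OF finite_carrier conj_a_iso conj_H_subset])
  qed
  then show ?thesis
    unfolding card_permutable_cyclic[OF finite_carrier] sum_subgroups by (intro sum.cong HOL.refl) simp
qed

theorem csd_eq:
  "csd G =
    (\<Sum>m1 | m1 dvd m. \<Sum>n1 | n1 dvd n.
        real_of_int (gcd (int m1) (zm_quot r n n1)) *
        real (CF2 (subgroup_generated G {a [^] m1, b [^] n1})))
    / (\<Sum>m1 | m1 dvd m. \<Sum>n1 | n1 dvd n \<and> int (m div m1) dvd int r ^ n1 - 1.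
        real_of_int (gcd (int m1) (zm_quot r n n1)))\<^sup>2"
  by (simp add: csd_def card_permutable_pairs card_cyclic_subgroups flip: int_num_conj)

section \<open>The example of order 36\<close>

text \<open>By \<open>r1\<close> the element \<open>b ^ n1\<close> is central, so
  \<open>conj_H m1 n1 0\<close> is normal and permutes with every subset.\<close>

lemma conj_H_commute:
  assumes m1: "m1 dvd m" and n1: "n1 dvd n" and r1: "[r ^ n1 = 1] (mod m)" and K: "K \<subseteq> carrier G"
  shows "conj_H m1 n1 0 <#> K = K <#> conj_H m1 n1 0"
proof -
  let ?H = "conj_H m1 n1 0"
  have trivial_action: "[i * r ^ j' = i] (mod m)" if dvd: "n1 dvd j'" for i j'
  proof -
    obtain k where k: "j' = n1 * k" using dvd by (rule dvdE)
    have "[i * r ^ j' = i * 1 ^ k] (mod m)"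
      unfolding k power_mult by (intro cong_mult cong_pow r1 cong_refl)
    then show ?thesis by simp
  qed
  \<comment> \<open>The power \<open>r ^ ((n - 1) * j)\<close> inverts \<open>r ^ j\<close> modulo
    \<open>m\<close>, because the exponents add up to \<open>n * j\<close>.\<close>
  have r_inverse: "[i * r ^ ((n - 1) * j) * r ^ j = i] (mod m)" for i j
  proof -
    have "(n - 1) * j + j = n * j" using n by (cases n) simp_all
    then have eq: "i * r ^ ((n - 1) * j) * r ^ j = i * (r ^ n) ^ j"
      by (simp add: mult.assoc flip: power_add power_mult)
    have "[i * (r ^ n) ^ j = i * 1 ^ j] (mod m)"
      by (intro cong_mult cong_pow r cong_refl)
    then show ?thesis unfolding eq power_one mult_1_right .
  qed
  show ?thesis
  proof (intro equalityI subsetI)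
    fix z assume "z \<in> ?H <#> K"
    then obtain h x where hx: "h \<in> ?H" "x \<in> K" "z = h \<otimes> x" by (auto simp: set_mult_def)
    from hx(1) obtain i' j' where h: "h = nf i' j'" "n1 dvd j'" "m1 dvd i'" by (auto simp: conj_H_def)
    obtain i j where x: "x = nf i j" using hx(2) K by (blast elim: carrierE)
    have "[i' * r ^ j + i = i * r ^ j' + i' * r ^ j] (mod m)"
      using cong_add[OF cong_sym[OF trivial_action[OF h(2), of i]] cong_refl[of "i' * r ^ j"]]
      by (simp add: add.commute)
    then have "z = x \<otimes> nf (i' * r ^ j) j'"
      by (simp add: hx h x nf_mult nf_eq_iff add.commute)
    moreover have "nf (i' * r ^ j) j' \<in> ?H" using h by (simp add: nf_in_conj_H_iff[OF m1 n1] flip: of_nat_power of_nat_mult)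
    ultimately show "z \<in> K <#> ?H" using hx(2) by (auto simp: set_mult_def)
  next
    fix z assume "z \<in> K <#> ?H"
    then obtain h x where hx: "h \<in> ?H" "x \<in> K" "z = x \<otimes> h" by (auto simp: set_mult_def)
    from hx(1) obtain i' j' where h: "h = nf i' j'" "n1 dvd j'" "m1 dvd i'" by (auto simp: conj_H_def)
    obtain i j where x: "x = nf i j" using hx(2) K by (blast elim: carrierE)
    have "[i * r ^ j' + i' = i' * r ^ ((n - 1) * j) * r ^ j + i] (mod m)"
      using cong_add[OF trivial_action[OF h(2), of i] cong_sym[OF r_inverse[of i' j]]]
      by (simp add: add.commute)
    then have "z = nf (i' * r ^ ((n - 1) * j)) j' \<otimes> x"
      by (simp add: hx h x nf_mult nf_eq_iff add.commute)
    moreover have "nf (i' * r ^ ((n - 1) * j)) j' \<in> ?H"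
      using h by (simp add: nf_in_conj_H_iff[OF m1 n1] flip: of_nat_power of_nat_mult)
    ultimately show "z \<in> ?H <#> K" using hx(2) by (auto simp: set_mult_def)
  qed
qed

end

text \<open>The permuting pairs are counted directly. \<open>?B\<close> consists of the nine Sylow
  2-subgroups. The other six cyclic subgroups have \<open>n1 = 2\<close> or \<open>n1 = 4\<close>
  and permute with everything, since \<open>8 ^ 2 = 1\<close> modulo 9. Two distinct members of
  \<open>?B\<close> never permute, so \<open>15 * 15 - 9 * 9 + 9 = 153\<close> pairs remain.\<close>

lemma csd_metacyclic_9_4_8:
  assumes "metacyclic G a b 9 4 8"
  shows "csd G = 17 / 25"
proof -
  interpret metacyclic G a b 9 4 8 by (rule assms)
  have dvd_9: "m1 dvd 9 \<longleftrightarrow> m1 \<in> {1, 3, 9}" for m1 :: nat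
  proof
    assume dvd: "m1 dvd 9"
    then have "m1 \<le> 9" by (rule dvd_imp_le) simp
    then have "m1 = 0 \<or> m1 = 1 \<or> m1 = 2 \<or> m1 = 3 \<or> m1 = 4 \<or> m1 = 5 \<or> m1 = 6 \<or> m1 = 7 \<or> m1 = 8 \<or> m1 = 9"
      by arith
    then show "m1 \<in> {1, 3, 9}" using dvd by (elim disjE) simp_all
  qed auto
  have dvd_4: "n1 dvd 4 \<longleftrightarrow> n1 \<in> {1, 2, 4}" for n1 :: nat
  proof
    assume dvd: "n1 dvd 4"
    then have "n1 \<le> 4" by (rule dvd_imp_le) simp
    then have "n1 = 0 \<or> n1 = 1 \<or> n1 = 2 \<or> n1 = 3 \<or> n1 = 4" by arith
    then show "n1 \<in> {1, 2, 4}" using dvd by (elim disjE) simp_all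
  qed auto
  have quot: "zm_quot 8 4 (Suc 0) = 585" "zm_quot 8 4 2 = 65" "zm_quot 8 4 4 = 1"
    by (simp_all add: zm_quot_def)
  have num: "num_conj 9 (Suc 0) = 9" "num_conj 1 2 = 1" "num_conj 3 2 = 1" "num_conj 9 2 = 1"
    "num_conj 1 4 = 1" "num_conj 3 4 = 1" "num_conj 9 4 = 1"
    by (simp_all add: num_conj_def quot gcd_non_0_int)
  have sets: "{m1. m1 dvd (9::nat)} = {1, 3, 9}"
    "{n1. n1 dvd (4::nat) \<and> int (9 div 1) dvd 8 ^ n1 - 1} = {2, 4}"
    "{n1. n1 dvd (4::nat) \<and> int (9 div 3) dvd 8 ^ n1 - 1} = {2, 4}"
    "{n1. n1 dvd (4::nat) \<and> int (9 div 9) dvd 8 ^ n1 - 1} = {1, 2, 4}"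
    by (auto simp: dvd_9 dvd_4)
  let ?C = "cyclic_subgroups G" and ?B = "conj_H 9 1 ` {..<9}"
  have "card ?C = (\<Sum>m1\<in>{1, 3, 9}. \<Sum>n1 | n1 dvd 4 \<and> int (9 div m1) dvd 8 ^ n1 - 1. num_conj m1 n1)"
    using card_cyclic_subgroups by (simp add: sets(1) del: sum.insert)
  also have "\<dots> = 15" using sets(2-) num by simp
  finally have card_C: "card ?C = 15" .
  have inj: "inj_on (conj_H 9 1) {..<9}"
    using conj_H_unique[of 9 1 _ 9 1] num by (auto simp: inj_on_def)
  then have card_B: "card ?B = 9" by (simp add: card_image)
  have BC: "?B \<subseteq> ?C"
    by (auto simp: conj_H_cyclic_iff)
  have commute: "H <#>\<^bsub>G\<^esub> K = K <#>\<^bsub>G\<^esub> H" if H: "H \<in> ?C" "H \<notin> ?B" and K: "K \<in> ?C" for H K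
  proof -
    obtain m1 n1 t where H': "m1 dvd 9" "n1 dvd 4" "t < num_conj m1 n1" "H = conj_H m1 n1 t"
      using subgroup_eq_conj_H[OF cyclic_subgroupsD[OF H(1)]] by metis
    then have "int (9 div m1) dvd 8 ^ n1 - 1" using H(1) conj_H_cyclic_iff by simp
    then have "(m1 = 9 \<and> n1 = 1) \<or> n1 = 2 \<or> n1 = 4" using H'(1,2) by (auto simp: dvd_9 dvd_4)
    moreover have "\<not> (m1 = 9 \<and> n1 = 1)" using H(2) H'(3,4) num by auto
    ultimately have n1: "n1 = 2 \<or> n1 = 4" by blast
    then have "t = 0" using H'(1,3) num by (auto simp: dvd_9)
    moreover have "[8 ^ n1 = 1] (mod (9::nat))" using n1 by (auto simp: cong_def)
    ultimately show ?thesis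
      using conj_H_commute[OF H'(1,2)] H'(4) subgroup.subset[OF cyclic_subgroupsD[OF K]] by simp
  qed
  have not_commute: "t = t'"
    if t: "t < 9" "t' < 9" and eq: "conj_H 9 1 t <#>\<^bsub>G\<^esub> conj_H 9 1 t' = conj_H 9 1 t' <#>\<^bsub>G\<^esub> conj_H 9 1 t" for t t'
  proof -
    \<comment> \<open>These are the conjugates of \<open>b\<close> by \<open>a ^ t\<close> and
      \<open>a ^ t'\<close>; indeed \<open>2 * t + t * (8 - 1) = 9 * t\<close>. Their product must
      also be a product in the opposite order.\<close>
    have "nf (2 * t) 1 \<in> conj_H 9 1 t" "nf (2 * t') 1 \<in> conj_H 9 1 t'"
      by (simp_all add: nf_in_conj_H_iff)
    then have "nf (2 * t) 1 \<otimes>\<^bsub>G\<^esub> nf (2 * t') 1 \<in> conj_H 9 1 t' <#>\<^bsub>G\<^esub> conj_H 9 1 t"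
      unfolding eq[symmetric] by (auto simp: set_mult_def)
    then obtain i j i' j' where h: "9 dvd int i + int t * (8 ^ j - 1)"
      and k: "9 dvd int i' + int t' * (8 ^ j' - 1)"
      and "nf (2 * t) 1 \<otimes>\<^bsub>G\<^esub> nf (2 * t') 1 = nf i' j' \<otimes>\<^bsub>G\<^esub> nf i j"
      unfolding set_mult_def conj_H_def by auto
    then have c: "[2 * t * 8 + 2 * t' = i' * 8 ^ j + i] (mod 9)" "[1 + 1 = j' + j] (mod 4)"
      unfolding nf_mult nf_eq_iff by (simp_all only: power_one_right)
    \<comment> \<open>Since 8 is -1 modulo 9, only the parities of \<open>j\<close> and
      \<open>j'\<close> matter, and \<open>c(2)\<close> makes them equal.\<close>
    have pow: "[(8::int) ^ j = (- 1) ^ j] (mod 9)" for j by (intro cong_pow) (simp add: cong_def)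
    have "[int (2 * t * 8 + 2 * t') = int (i' * 8 ^ j + i)] (mod int 9)"
      using c(1) by (simp only: cong_int_iff)
    then have "[16 * int t + 2 * int t' = int i' * 8 ^ j + int i] (mod 9)" by (simp add: algebra_simps)
    also have "[int i' * 8 ^ j + int i = int i' * (- 1) ^ j + int i] (mod 9)"
      by (intro cong_add cong_mult pow cong_refl)
    finally have c': "[16 * int t + 2 * int t' = int i' * (- 1) ^ j + int i] (mod 9)" .
    have "[int i + int t * (8 ^ j - 1) = int i + int t * ((- 1) ^ j - 1)] (mod 9)"
      "[int i' + int t' * (8 ^ j' - 1) = int i' + int t' * ((- 1) ^ j' - 1)] (mod 9)"
      by (intro cong_add cong_mult cong_diff pow cong_refl)+
    then have hk: "9 dvd int i + int t * ((- 1) ^ j - 1)" "9 dvd int i' + int t' * ((- 1) ^ j' - 1)"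
      using h k by (simp_all add: cong_dvd_iff)
    have "even (j' + j)" using c(2) unfolding cong_def by presburger
    then have "even j \<and> even j' \<or> odd j \<and> odd j'" by auto
    then have "9 dvd int t - int t'"
    proof
      assume even: "even j \<and> even j'"
      \<comment> \<open>Here 9 divides \<open>i\<close> and \<open>i'\<close>, hence
        \<open>16 * t + 2 * t'\<close>; the factor 5 is the inverse of 2 modulo 9.\<close>
      have "int t - int t' = 9 * (9 * int t + int t')
          - 5 * (16 * int t + 2 * int t' - (int i' + int i)) - 5 * int i' - 5 * int i"
        by simp
      also have "9 dvd \<dots>"
        by (rule dvd_diff[OF dvd_diff[OF dvd_diff[OF dvd_triv_left dvd_mult] dvd_mult] dvd_mult])
          (use hk c' even in \<open>simp_all add: cong_iff_dvd_diff\<close>)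
      finally show ?thesis .
    next
      assume odd: "odd j \<and> odd j'"
      \<comment> \<open>Here \<open>i\<close> is \<open>2 * t\<close> and \<open>i'\<close> is
        \<open>2 * t'\<close> modulo 9, so 9 divides \<open>14 * t + 4 * t'\<close>, and doubling
        this gives \<open>t - t'\<close> modulo 9.\<close>
      have "int t - int t' = 2 * ((16 * int t + 2 * int t' - (int i' * - 1 + int i))
          + (int i + int t * (- 1 - 1)) - (int i' + int t' * (- 1 - 1))) - 9 * (3 * int t + int t')"
        by simp
      also have "9 dvd \<dots>"
        by (rule dvd_diff[OF dvd_mult[OF dvd_diff[OF dvd_add]] dvd_triv_left])
          (use hk c' odd in \<open>simp_all add: cong_iff_dvd_diff\<close>)
      finally show ?thesis .
    qed
    then have "[int t = int t'] (mod int 9)" by (simp add: cong_iff_dvd_diff)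
    then show "t = t'" using t unfolding cong_int_iff by (rule cong_less_modulus_unique_nat)
  qed
  have "{(H, K). H \<in> ?C \<and> K \<in> ?C \<and> H <#>\<^bsub>G\<^esub> K = K <#>\<^bsub>G\<^esub> H} =
      (?C \<times> ?C - ?B \<times> ?B) \<union> (\<lambda>H. (H, H)) ` ?B" (is "?P = _")
  proof (intro equalityI subsetI)
    fix p assume "p \<in> ?P"
    then obtain H K where p: "p = (H, K)" "H \<in> ?C" "K \<in> ?C" "H <#>\<^bsub>G\<^esub> K = K <#>\<^bsub>G\<^esub> H" by blast
    show "p \<in> (?C \<times> ?C - ?B \<times> ?B) \<union> (\<lambda>H. (H, H)) ` ?B"
    proof (cases "H \<in> ?B \<and> K \<in> ?B")
      case True
      then obtain t t' where "t < 9" "t' < 9" "H = conj_H 9 1 t" "K = conj_H 9 1 t'" by blast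
      then have "H = K" using not_commute[of t t'] p(4) by simp
      then show ?thesis using p(1) True by (intro UnI2) (simp add: image_iff)
    next
      case False
      then show ?thesis using p(1-3) by (intro UnI1) blast
    qed
  next
    fix p assume "p \<in> (?C \<times> ?C - ?B \<times> ?B) \<union> (\<lambda>H. (H, H)) ` ?B"
    then show "p \<in> ?P"
    proof
      assume "p \<in> ?C \<times> ?C - ?B \<times> ?B"
      then obtain H K where p: "p = (H, K)" "H \<in> ?C" "K \<in> ?C" "H \<notin> ?B \<or> K \<notin> ?B" by blast
      have "H <#>\<^bsub>G\<^esub> K = K <#>\<^bsub>G\<^esub> H"
        using p(4) commute[OF p(2) _ p(3)] commute[OF p(3) _ p(2)] by (elim disjE) simp_all
      then show ?thesis using p(1-3) by simp
    next
      assume "p \<in> (\<lambda>H. (H, H)) ` ?B"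
      then show ?thesis using BC by blast
    qed
  qed
  moreover have "card ((?C \<times> ?C - ?B \<times> ?B) \<union> (\<lambda>H. (H, H)) ` ?B) = 153"
  proof -
    have fin: "finite ?C" by (rule finite_cyclic_subgroups[OF finite_carrier])
    have "card (?C \<times> ?C - ?B \<times> ?B) = card (?C \<times> ?C) - card (?B \<times> ?B)"
      using BC by (intro card_Diff_subset) auto
    then have "card (?C \<times> ?C - ?B \<times> ?B) = 15 * 15 - 9 * 9"
      by (simp only: card_cartesian_product card_C card_B)
    moreover have "card ((\<lambda>H. (H, H)) ` ?B) = 9" using card_B by (subst card_image) (simp_all add: inj_on_def)
    ultimately show ?thesis
      using fin by (subst card_Un_disjoint) auto
  qed
  ultimately show ?thesis by (simp add: csd_def card_C)
qed

section \<open>The presented group as a metacyclic group\<close>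

text \<open>The action of words on pairs of residues by right multiplication on \<open>b ^ j a ^ i\<close>
  shows that the presented group is not smaller than expected.\<close>

fun zm_step :: "nat \<Rightarrow> nat \<Rightarrow> nat \<Rightarrow> nat \<times> nat \<Rightarrow> zm_gen \<times> bool \<Rightarrow> nat \<times> nat" where
  "zm_step m n r (i, j) (GenA, True) = ((i + 1) mod m, j)"
| "zm_step m n r (i, j) (GenA, False) = ((i + (m - 1)) mod m, j)"
| "zm_step m n r (i, j) (GenB, True) = (i * r mod m, (j + 1) mod n)"
| "zm_step m n r (i, j) (GenB, False) = (i * r ^ (n - 1) mod m, (j + (n - 1)) mod n)"

context
  fixes m n r :: nat
  assumes m: "m > 0" and n: "n > 0" and r: "[r ^ n = 1] (mod m)"
begin

abbreviation act :: "zm_gen word \<Rightarrow> nat \<times> nat \<Rightarrow> nat \<times> nat" where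
  "act u s \<equiv> foldl (zm_step m n r) s u"

lemma zm_step_closed: "s \<in> {..<m} \<times> {..<n} \<Longrightarrow> zm_step m n r s g \<in> {..<m} \<times> {..<n}"
  using m n by (cases "(m, n, r, s, g)" rule: zm_step.cases) auto

lemma act_closed: "s \<in> {..<m} \<times> {..<n} \<Longrightarrow> act u s \<in> {..<m} \<times> {..<n}"
proof (induction u arbitrary: s)
  case (Cons g u)
  show ?case using Cons.IH[OF zm_step_closed[OF Cons.prems]] by simp
qed simp

lemma mult_r_pow_mod: "i * r ^ n mod m = i mod m"
  using cong_mult[OF cong_refl[of i] r] by (simp add: cong_def)

text \<open>A letter and its formal inverse act as mutually inverse permutations; for
  \<open>GenB\<close> this rests on \<open>r * r ^ (n - 1) = r ^ n\<close>, which is 1 modulo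
  \<open>m\<close>.\<close>

lemma zm_step_cancel:
  assumes "s \<in> {..<m} \<times> {..<n}"
  shows "zm_step m n r (zm_step m n r s (x, e)) (x, \<not> e) = s"
proof -
  obtain i j where s: "s = (i, j)" "i < m" "j < n" using assms by auto
  have "r * r ^ (n - 1) = r ^ n" "r ^ (n - 1) * r = r ^ n" using n by (cases n; simp)+
  then have "(i * r mod m) * r ^ (n - 1) mod m = i" "(i * r ^ (n - 1) mod m) * r mod m = i"
    using s by (simp_all only: mod_mult_left_eq mult.assoc mult_r_pow_mod mod_less)
  moreover have "((i + 1) mod m + (m - 1)) mod m = i" "((i + (m - 1)) mod m + 1) mod m = i"
    "((j + 1) mod n + (n - 1)) mod n = j" "((j + (n - 1)) mod n + 1) mod n = j"
    using s m n by (simp_all only: mod_add_left_eq) simp_all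
  ultimately show ?thesis unfolding s(1) by (cases x; cases e) (simp_all only: zm_step.simps HOL.simp_thms)
qed

lemma act_replicate_A: "i < m \<Longrightarrow> act (replicate k (GenA, True)) (i, j) = ((i + k) mod m, j)"
  using m by (induction k arbitrary: i) (simp_all add: mod_simps)

lemma act_replicate_B:
  "i < m \<Longrightarrow> j < n \<Longrightarrow> act (replicate k (GenB, True)) (i, j) = (i * r ^ k mod m, (j + k) mod n)"
  using m n by (induction k arbitrary: i j) (simp_all add: mod_simps mult.assoc)

text \<open>The prefix of a word only changes the state at which a relation is tested, so each
  relation is checked at an arbitrary state. The conjugation relation holds because
  \<open>(i * r ^ (n - 1) + 1) * r\<close> equals \<open>i + r\<close> modulo
  \<open>m\<close>.\<close>

lemma act_word_eq:
  assumes "word_eq (zm_relations m n r) u v" and "s \<in> {..<m} \<times> {..<n}"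
  shows "act u s = act v s"
  using assms
proof (induction arbitrary: s rule: word_eq.induct)
  case (cancel u x e v)
  then show ?case using zm_step_cancel[OF act_closed[OF cancel(1), of u]] by simp
next
  case (rel p q u v)
  have "act p s' = act q s'" if s': "s' \<in> {..<m} \<times> {..<n}" for s'
  proof -
    obtain i j where s: "s' = (i, j)" "i < m" "j < n" using s' by (cases s') auto
    have "act [(GenB, False), (GenA, True), (GenB, True)] s' = ((i * r ^ (n - 1) + 1) * r mod m, j)"
      using s n by (simp add: mod_simps)
    also have "(i * r ^ (n - 1) + 1) * r = i * r ^ n + r"
      using n by (cases n) (simp_all add: algebra_simps)
    also have "(i * r ^ n + r) mod m = (i + r) mod m"
      using mult_r_pow_mod by (metis mod_add_left_eq)
    finally show ?thesis
      using rel(1) s m n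
      by (auto simp: zm_relations_def act_replicate_A act_replicate_B mult_r_pow_mod)
  qed
  then show ?case using act_closed[OF rel(2)] by simp
qed auto

end

lemma word_class_pow:
  "word_class R [(x, True)] [^]\<^bsub>presented_group R\<^esub> k = word_class R (replicate k (x, True))" for k :: nat
proof -
  interpret group "presented_group R" by (rule group_presented_group)
  show ?thesis
  proof (induction k)
    case 0
    show ?case by (simp add: presented_group_def)
  next
    case (Suc k)
    then show ?case by (simp add: presented_group_mult replicate_append_same)
  qed
qed

lemma carrier_presented_group_subset_generate:
  "carrier (presented_group R) \<subseteq> generate (presented_group R) (range (\<lambda>x. word_class R [(x, True)]))"
proof -
  interpret group "presented_group R" by (rule group_presented_group)
  let ?S = "range (\<lambda>x. word_class R [(x, True)])"
  have one: "word_class R [] = \<one>\<^bsub>presented_group R\<^esub>" by (simp add: presented_group_def)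
  have closed: "word_class R u \<in> carrier (presented_group R)" for u by (simp add: presented_group_def)
  have gen: "word_class R [(x, e)] \<in> generate (presented_group R) ?S" for x e
  proof (cases e)
    case False
    have "word_class R [(x, False)] \<otimes>\<^bsub>presented_group R\<^esub> word_class R [(x, True)] = \<one>\<^bsub>presented_group R\<^esub>"
      unfolding presented_group_mult one[symmetric] word_class_eq_iff
      using word_eq.cancel[of R "[]" x False "[]"] by simp
    then have "inv\<^bsub>presented_group R\<^esub> (word_class R [(x, True)]) = word_class R [(x, False)]"
      by (simp add: inv_equality closed)
    then show ?thesis
      using False generate.inv[of "word_class R [(x, True)]" ?S "presented_group R"] by simp
  qed (auto intro: generate.incl)
  have "word_class R u \<in> generate (presented_group R) ?S" for u
  proof (induction u)
    case Nil
    show ?case by (simp add: one generate.one)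
  next
    case (Cons y u)
    obtain x e where "y = (x, e)" by force
    then show ?case using generate.eng[OF gen[of x e] Cons] by (simp add: presented_group_mult)
  qed
  moreover have "carrier (presented_group R) = range (word_class R)" by (simp add: presented_group_def)
  ultimately show ?thesis by (simp only: image_subset_iff) simp
qed

lemma metacyclic_ZM:
  assumes m: "m > 0" and n: "n > 0" and coprime: "coprime m n" and r: "[r ^ n = 1] (mod m)"
  shows "metacyclic (ZM m n r) (zm_a m n r) (zm_b m n r) m n r"
proof -
  let ?R = "zm_relations m n r"
  interpret group "ZM m n r" unfolding ZM_def by (rule group_presented_group)
  have one: "\<one>\<^bsub>ZM m n r\<^esub> = word_class ?R []" by (simp add: ZM_def presented_group_def)
  have mult: "word_class ?R u \<otimes>\<^bsub>ZM m n r\<^esub> word_class ?R v = word_class ?R (u @ v)" for u v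
    by (simp add: ZM_def presented_group_mult)
  have a_pow: "zm_a m n r [^]\<^bsub>ZM m n r\<^esub> k = word_class ?R (replicate k (GenA, True))"
    and b_pow: "zm_b m n r [^]\<^bsub>ZM m n r\<^esub> k = word_class ?R (replicate k (GenB, True))" for k :: nat
    by (simp_all add: ZM_def zm_a_def zm_b_def word_class_pow)
  have rel: "word_eq ?R (u @ p) (u @ q)" if "(p, q) \<in> ?R" for u p q
    using word_eq.rel[OF that, of u "[]"] by simp
  show ?thesis
  proof
    show "zm_a m n r \<in> carrier (ZM m n r)" "zm_b m n r \<in> carrier (ZM m n r)"
      by (simp_all add: zm_a_def zm_b_def ZM_def presented_group_def)
    show "zm_a m n r [^]\<^bsub>ZM m n r\<^esub> m = \<one>\<^bsub>ZM m n r\<^esub>" "zm_b m n r [^]\<^bsub>ZM m n r\<^esub> n = \<one>\<^bsub>ZM m n r\<^esub>"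
      unfolding a_pow b_pow one word_class_eq_iff
      using rel[of _ _ "[]"] by (simp_all add: zm_relations_def)
    \<comment> \<open>Inserting a cancelling pair of \<open>GenB\<close> letters in front exposes
      the left side of the conjugation relation.\<close>
    have "word_eq ?R [(GenA, True), (GenB, True)]
        [(GenB, True), (GenB, False), (GenA, True), (GenB, True)]"
      using word_eq.sym[OF word_eq.cancel[of ?R "[]" GenB True "[(GenA, True), (GenB, True)]"]] by simp
    moreover have "word_eq ?R [(GenB, True), (GenB, False), (GenA, True), (GenB, True)]
        ((GenB, True) # replicate r (GenA, True))"
      using rel[of "[(GenB, False), (GenA, True), (GenB, True)]" "replicate r (GenA, True)" "[(GenB, True)]"]
      by (simp add: zm_relations_def)
    ultimately have "word_eq ?R [(GenA, True), (GenB, True)] ((GenB, True) # replicate r (GenA, True))"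
      by (rule word_eq.trans)
    then show "zm_a m n r \<otimes>\<^bsub>ZM m n r\<^esub> zm_b m n r = zm_b m n r \<otimes>\<^bsub>ZM m n r\<^esub> zm_a m n r [^]\<^bsub>ZM m n r\<^esub> r"
      unfolding a_pow by (simp add: zm_a_def zm_b_def mult word_class_eq_iff)
    have "range (\<lambda>x. word_class ?R [(x, True)]) = {zm_a m n r, zm_b m n r}"
    proof -
      have "word_class ?R [(x, True)] \<in> {zm_a m n r, zm_b m n r}" for x
        by (cases x) (simp_all add: zm_a_def zm_b_def)
      moreover have "zm_a m n r \<in> range (\<lambda>x. word_class ?R [(x, True)])"
        "zm_b m n r \<in> range (\<lambda>x. word_class ?R [(x, True)])"
        unfolding zm_a_def zm_b_def by (rule rangeI)+
      ultimately show ?thesis by blast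
    qed
    then show "carrier (ZM m n r) \<subseteq> generate (ZM m n r) {zm_a m n r, zm_b m n r}"
      using carrier_presented_group_subset_generate[of ?R] by (simp add: ZM_def)
  next
    fix i j i' j' :: nat
    assume "zm_b m n r [^]\<^bsub>ZM m n r\<^esub> j \<otimes>\<^bsub>ZM m n r\<^esub> zm_a m n r [^]\<^bsub>ZM m n r\<^esub> i =
      zm_b m n r [^]\<^bsub>ZM m n r\<^esub> j' \<otimes>\<^bsub>ZM m n r\<^esub> zm_a m n r [^]\<^bsub>ZM m n r\<^esub> i'"
    then have "word_eq ?R (replicate j (GenB, True) @ replicate i (GenA, True))
        (replicate j' (GenB, True) @ replicate i' (GenA, True))"
      by (simp add: a_pow b_pow mult word_class_eq_iff)
    \<comment> \<open>The word for \<open>b ^ j a ^ i\<close> carries \<open>(0, 0)\<close> to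
      \<open>(i mod m, j mod n)\<close>, so equal classes have equal residues.\<close>
    from act_word_eq[OF m n r this, of "(0, 0)"] m n
    show "[i = i'] (mod m) \<and> [j = j'] (mod n)"
      by (simp add: act_replicate_A[OF m n r] act_replicate_B[OF m n r] cong_def)
  qed (use assms in auto)
qed

theorem theorem4p4:
  shows "(\<forall>m n r :: nat.
      1 \<le> m \<longrightarrow> 1 \<le> n \<longrightarrow> gcd m n = 1 \<longrightarrow> gcd (int m) (int r - 1) = 1 \<longrightarrow> [r ^ n = 1] (mod m) \<longrightarrow>
      csd (ZM m n r) =
        (\<Sum>m1 | m1 dvd m. \<Sum>n1 | n1 dvd n.
            real_of_int (gcd (int m1) (zm_quot r n n1)) * real (CF2 (zm_H0 m n r m1 n1)))
        / (\<Sum>m1 | m1 dvd m. \<Sum>n1 | n1 dvd n \<and> int (m div m1) dvd int r ^ n1 - 1.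
            real_of_int (gcd (int m1) (zm_quot r n n1)))\<^sup>2)
    \<and> csd (ZM 9 4 8) = 17 / 25"
proof (intro conjI allI impI)
  fix m n r :: nat
  assume "1 \<le> m" "1 \<le> n" "gcd m n = 1" "[r ^ n = 1] (mod m)"
  then interpret metacyclic "ZM m n r" "zm_a m n r" "zm_b m n r" m n r
    by (intro metacyclic_ZM) (simp_all add: coprime_iff_gcd_eq_1)
  show "csd (ZM m n r) =
        (\<Sum>m1 | m1 dvd m. \<Sum>n1 | n1 dvd n.
            real_of_int (gcd (int m1) (zm_quot r n n1)) * real (CF2 (zm_H0 m n r m1 n1)))
        / (\<Sum>m1 | m1 dvd m. \<Sum>n1 | n1 dvd n \<and> int (m div m1) dvd int r ^ n1 - 1.
            real_of_int (gcd (int m1) (zm_quot r n n1)))\<^sup>2"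
    unfolding zm_H0_def by (rule csd_eq)
next
  have "coprime (9::nat) 4" by (simp add: coprime_iff_gcd_eq_1 gcd_non_0_nat)
  then show "csd (ZM 9 4 8) = 17 / 25"
    by (intro csd_metacyclic_9_4_8[OF metacyclic_ZM]) (simp_all add: cong_def)
qed

end
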